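(* Let $d\in\mathbb{N}$ (with $d\ge 1$). Then: (1) $D_{d+1}[0,1]^d$ is a 1-prevalent subset of $(C[0,1]^d,d_\infty)$; (2) for every $\alpha\in[d,d+1)$ the set $D_\alpha[0,1]^d$ is a 1-prevalent subset of $(C_\alpha[0,1]^d,d_{\alpha,d})$.
   Context: $C[0,1]^d$ is the real vector space of continuous functions $f:[0,1]^d\to\mathbb{R}$, and $d_\infty$ is the metric given by the sup norm $\|\cdot\|_\infty$. The graph of $f$ is $G_f=\{(\mathbf{x},f(\mathbf{x})):\mathbf{x}\in[0,1]^d\}\subset\mathbb{R}^{d+1}$. For a bounded set $F$ in Euclidean space, $\underline{\dim}_{\mathrm B}F$ and $\overline{\dim}_{\mathrm B}F$ are the lower and upper limits as $\delta\to0$ of $\log N_\delta(F)/(-\log\delta)$, where $N_\delta(F)$ is the number of cubes of a $\delta$-mesh which intersect $F$. For $\alpha\in[d,d+1]$ define $C_\alpha[0,1]^d=\{f\in C[0,1]^d:\overline{\dim}_{\mathrm B}G_f\le\alpha\}$ (so $C_{d+1}[0,1]^d=C[0,1]^d$) and $D_\alpha[0,1]^d=\{f\in C_\alpha[0,1]^d:\underline{\dim}_{\mathrm B}G_f=\overline{\dim}_{\mathrm B}G_f=\alpha\}$. Metric $d_{\alpha,d}$: for $\delta>0$, $\Delta_\delta^d$ is the collection of cubes $[n_1\delta,(n_1+1)\delta]\times\cdots\times[n_d\delta,(n_d+1)\delta]$ with integers $0\le n_i\le\lceil\delta^{-1}\rceil-1$. For $S\in\Delta_\delta^d$, $R_f(S)=\sup|f(x)-f(y)|$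 over $x,y\in S\cap[0,1]^d$. For $\beta\ge d$ put $\|f\|_{\beta,d}=\|f\|_\infty+\sup_{0<\delta\le1}\delta^{\beta-1}\sum_{S\in\Delta_\delta^d}R_f(S)$. For $\alpha\in[d,d+1)$ and $f,g\in C_\alpha[0,1]^d$, $d_{\alpha,d}(f,g)=\sum_{k=1}^\infty\min\{2^{-k},\|f-g\|_{\alpha+\frac1k,d}\}$. With this metric $C_\alpha[0,1]^d$ is a completely metrizable topological vector space. Let $X$ be a completely metrizable topological vector space. A Borel set $F\subseteq X$ is $k$-prevalent if there is a $k$-dimensional subspace $P\subseteq X$ (a probe for $F$) such that $\mathcal{L}_P(X\setminus(F+x))=0$ for all $x\in X$, where $\mathcal{L}_P$ is $k$-dimensional Lebesgue measure on $P$ (via a linear identification $P\cong\mathbb{R}^k$), regarded as a measure on $X$ by $\mathcal{L}_P(A)=\mathcal{L}_P(A\cap P)$. *)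

theory Defs
  imports "HOL-Analysis.Analysis"
begin

section \<open>The Banach space of continuous functions on the unit cube\<close>

text \<open>
  The points of the cube form a type of their own, with the Euclidean metric, so that
  \<open>'d unit_cube \<Rightarrow>\<^sub>C real\<close> is the space of continuous functions on the cube, the library's
  \<open>norm\<close> and \<open>dist\<close> on it being the sup norm and the sup metric. The two lemmas below show
  that the boundedness built into that type excludes no continuous function.
\<close>

typedef (overloaded) ('d::finite) unit_cube = "{x :: real ^ 'd. \<forall>i. 0 \<le> x $ i \<and> x $ i \<le> 1}"
  morphisms pt Abs_unit_cube
  by (rule exI[of _ 0]) simp

instantiation unit_cube :: (finite) metric_space
begin

definition dist_unit_cube :: "'a unit_cube \<Rightarrow> 'a unit_cube \<Rightarrow> real"
  where "dist_unit_cube x y = dist (pt x) (pt y)"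

definition uniformity_unit_cube :: "('a unit_cube \<times> 'a unit_cube) filter"
  where "uniformity_unit_cube = (INF e\<in>{0<..}. principal {(x, y). dist x y < e})"

definition open_unit_cube :: "'a unit_cube set \<Rightarrow> bool"
  where "open_unit_cube U = (\<forall>x\<in>U. \<forall>\<^sub>F (x', y) in uniformity. x' = x \<longrightarrow> y \<in> U)"

instance
proof
  fix x y z :: "'a unit_cube"
  show "dist x y = 0 \<longleftrightarrow> x = y"
    by (simp add: dist_unit_cube_def pt_inject)
  show "dist x y \<le> dist x z + dist y z"
    by (simp add: dist_unit_cube_def dist_triangle2)
qed (rule uniformity_unit_cube_def open_unit_cube_def)+

end

lemma compact_UNIV_unit_cube: "compact (UNIV :: 'd::finite unit_cube set)"
proof -
  let ?C = "{x :: real ^ 'd. \<forall>i. 0 \<le> x $ i \<and> x $ i \<le> 1}"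
  have C: "?C = cbox 0 1"
    by (auto simp: mem_box_cart)
  have "continuous_on ?C (Abs_unit_cube :: real ^ 'd \<Rightarrow> 'd unit_cube)"
    unfolding continuous_on_iff
  proof (intro ballI allI impI)
    fix x :: "real ^ 'd" and e :: real
    assume "x \<in> ?C" "0 < e"
    then show "\<exists>r>0. \<forall>x'\<in>?C. dist x' x < r \<longrightarrow> dist (Abs_unit_cube x') (Abs_unit_cube x) < e"
      by (intro exI[of _ e] conjI ballI impI) (simp_all only: dist_unit_cube_def Abs_unit_cube_inverse)
  qed
  then have "compact (Abs_unit_cube ` ?C :: 'd unit_cube set)"
    by (rule compact_continuous_image) (simp only: C compact_cbox)
  then show ?thesis
    by (simp only: type_definition.Abs_image[OF type_definition_unit_cube])
qed

lemma continuous_imp_bcontfun: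
  fixes f :: "'d::finite unit_cube \<Rightarrow> real"
  assumes "continuous_on UNIV f"
  shows "f \<in> bcontfun"
  using assms compact_continuous_image[OF assms compact_UNIV_unit_cube]
  by (simp add: bcontfun_def compact_imp_bounded)

text \<open>\<open>(real ^ 'd) \<times> real\<close> plays the role of Euclidean space of dimension \<open>d + 1\<close>.\<close>

definition graph :: "('d::finite unit_cube \<Rightarrow>\<^sub>C real) \<Rightarrow> ((real ^ 'd) \<times> real) set"
  where "graph f = {(pt x, f x) | x. True}"


section \<open>Box dimensions\<close>

text \<open>The index \<open>n\<close> is only relevant on the standard basis, i.e. it is a vector of integers.\<close>

definition mesh_cube :: "real \<Rightarrow> ('a::euclidean_space \<Rightarrow> int) \<Rightarrow> 'a set"
  where "mesh_cube \<delta> n =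
    {x. \<forall>b\<in>Basis. of_int (n b) * \<delta> \<le> x \<bullet> b \<and> x \<bullet> b \<le> (of_int (n b) + 1) * \<delta>}"

definition box_count :: "real \<Rightarrow> 'a::euclidean_space set \<Rightarrow> nat"
  where "box_count \<delta> F = card {Q. (\<exists>n. Q = mesh_cube \<delta> n) \<and> Q \<inter> F \<noteq> {}}"

definition lower_box_dim :: "'a::euclidean_space set \<Rightarrow> ereal"
  where "lower_box_dim F =
    Liminf (at_right 0) (\<lambda>\<delta>. ereal (ln (real (box_count \<delta> F)) / (- ln \<delta>)))"

definition upper_box_dim :: "'a::euclidean_space set \<Rightarrow> ereal"
  where "upper_box_dim F =
    Limsup (at_right 0) (\<lambda>\<delta>. ereal (ln (real (box_count \<delta> F)) / (- ln \<delta>)))"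

definition C_space :: "real \<Rightarrow> ('d::finite unit_cube \<Rightarrow>\<^sub>C real) set"
  where "C_space \<alpha> = {f. upper_box_dim (graph f) \<le> ereal \<alpha>}"

definition D_space :: "real \<Rightarrow> ('d::finite unit_cube \<Rightarrow>\<^sub>C real) set"
  where "D_space \<alpha> =
    {f \<in> C_space \<alpha>. lower_box_dim (graph f) = ereal \<alpha> \<and> upper_box_dim (graph f) = ereal \<alpha>}"


section \<open>The metric on the spaces of functions with bounded graph dimension\<close>

definition unit_mesh :: "real \<Rightarrow> (real ^ 'd::finite) set set"
  where "unit_mesh \<delta> =
    {S. \<exists>n. (\<forall>b\<in>Basis. 0 \<le> n b \<and> n b \<le> \<lceil>1 / \<delta>\<rceil> - 1) \<and> S = mesh_cube \<delta> n}"

definition oscillation :: "('d::finite unit_cube \<Rightarrow>\<^sub>C real) \<Rightarrow> (real ^ 'd) set \<Rightarrow> real"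
  where "oscillation f S = Sup {\<bar>f x - f y\<bar> | x y. pt x \<in> S \<and> pt y \<in> S}"

text \<open>The value may be infinite for a general continuous function, hence the type \<open>ereal\<close>.\<close>

definition osc_norm :: "real \<Rightarrow> ('d::finite unit_cube \<Rightarrow>\<^sub>C real) \<Rightarrow> ereal"
  where "osc_norm \<beta> f = ereal (norm f) +
    (SUP \<delta>\<in>{0<..1}. ereal (\<delta> powr (\<beta> - 1) * (\<Sum>S\<in>unit_mesh \<delta>. oscillation f S)))"

definition dist_space ::
    "real \<Rightarrow> ('d::finite unit_cube \<Rightarrow>\<^sub>C real) \<Rightarrow> ('d unit_cube \<Rightarrow>\<^sub>C real) \<Rightarrow> real"
  where "dist_space \<alpha> f g =
    (\<Sum>k. real_of_ereal
       (min (ereal ((1 / 2) ^ Suc k)) (osc_norm (\<alpha> + 1 / real (Suc k)) (f - g))))"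


section \<open>Prevalence\<close>

text \<open>
  The ambient topological vector space is a linear subspace \<open>topspace T\<close> of a real vector
  space, with the vector space operations inherited from there and with topology \<open>T\<close>.
\<close>

definition borel_subset :: "'a topology \<Rightarrow> 'a set \<Rightarrow> bool"
  where "borel_subset T F \<longleftrightarrow> F \<in> sigma_sets (topspace T) {U. openin T U}"

definition is_basis :: "nat \<Rightarrow> (nat \<Rightarrow> 'a::real_vector) \<Rightarrow> 'a set \<Rightarrow> bool"
  where "is_basis k b P \<longleftrightarrow>
    inj_on b {..<k} \<and> independent (b ` {..<k}) \<and> span (b ` {..<k}) = P"

text \<open>
  \<open>lebesgue_null k b A\<close> says that \<open>A \<inter> P\<close> has \<open>k\<close>-dimensional Lebesgue measure zero, where \<open>P\<close>
  has basis \<open>b 0, \<dots>, b (k - 1)\<close> and is identified with the space of coordinate vectors (a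
  finite product of \<open>k\<close> real lines). The null sets do not depend on the choice of the basis.
  Membership in \<open>null_sets\<close> is used because \<open>emeasure\<close> is zero on every non-measurable set.
\<close>

definition lebesgue_null :: "nat \<Rightarrow> (nat \<Rightarrow> 'a::real_vector) \<Rightarrow> 'a set \<Rightarrow> bool"
  where "lebesgue_null k b A \<longleftrightarrow>
    {c \<in> {..<k} \<rightarrow>\<^sub>E UNIV. (\<Sum>i<k. c i *\<^sub>R b i) \<in> A}
      \<in> null_sets (completion (\<Pi>\<^sub>M i\<in>{..<k}. lborel))"

definition probe :: "'a::real_vector topology \<Rightarrow> nat \<Rightarrow> 'a set \<Rightarrow> 'a set \<Rightarrow> bool"
  where "probe T k F P \<longleftrightarrow> P \<subseteq> topspace T \<and>
    (\<exists>b. is_basis k b P \<and>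
      (\<forall>x\<in>topspace T. lebesgue_null k b (topspace T - (\<lambda>y. y + x) ` F)))"

definition k_prevalent :: "'a::real_vector topology \<Rightarrow> nat \<Rightarrow> 'a set \<Rightarrow> bool"
  where "k_prevalent T k F \<longleftrightarrow> borel_subset T F \<and> (\<exists>P. probe T k F P)"

end

theory Submission
  imports Defs "HOL-Real_Asymp.Real_Asymp"
begin

text \<open>
  Let \<open>V \<delta> f\<close> be the sum of the oscillations of \<open>f\<close> over the \<open>\<delta>\<close>-mesh of the cube, a seminorm
  in \<open>f\<close>. Counting cubes column by column, the box count of the graph of \<open>f\<close> is comparable to
  \<open>\<delta> powr - d + V \<delta> f / \<delta>\<close>, so that membership in \<open>C_space \<alpha>\<close> is a growth condition on \<open>V\<close>.

  The probe is spanned by \<open>h(x) = w(x\<^sub>i)\<close> with a Takagi function \<open>w\<close>, for which \<open>V \<delta> h\<close> is, up to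
  logarithmic factors, \<open>\<delta> powr (1 - \<alpha>)\<close> for dyadic \<open>\<delta>\<close>. By the triangle inequality the \<open>c\<close> with
  \<open>V \<delta> (c h - g) < V \<delta> h / k\<^sup>2\<close>, where \<open>\<delta> = 1 / 2 ^ k\<close>, lie in an interval of length \<open>O(1 / k\<^sup>2)\<close>.
  By Borel--Cantelli almost every \<open>c\<close> is in only finitely many of these sets, and then the graph
  of \<open>c h - g\<close> has lower box dimension at least \<open>\<alpha>\<close>.

  \<open>D_space \<alpha>\<close> is Borel because box counts of graphs are upper semicontinuous in the sup norm, whose
  topology is coarser than that of \<open>dist_space \<alpha>\<close>.
\<close>

section \<open>Counting mesh cubes\<close>

lemma mesh_cube_eq_cbox:
  "mesh_cube \<delta> n = cbox (\<Sum>b\<in>Basis. (of_int (n b) * \<delta>) *\<^sub>R b) (\<Sum>b\<in>Basis. ((of_int (n b) + 1) * \<delta>) *\<^sub>R b)"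
  by (simp add: mesh_cube_def cbox_def)

lemma closed_mesh_cube: "closed (mesh_cube \<delta> n)"
  by (simp add: mesh_cube_eq_cbox closed_cbox)

lemma convex_mesh_cube: "convex (mesh_cube \<delta> n)"
  by (simp add: mesh_cube_eq_cbox convex_box)

lemma mesh_cube_cong: "(\<And>b. b \<in> Basis \<Longrightarrow> n b = m b) \<Longrightarrow> mesh_cube \<delta> n = mesh_cube \<delta> m"
  by (simp add: mesh_cube_def)

text \<open>Index functions that agree on \<open>Basis\<close> name the same cube. The restriction
  is the extensional one among them, so index sets can be taken as finite spaces
  \<open>PiE\<close>.\<close>

lemma mesh_cube_restrict: "mesh_cube \<delta> (restrict n Basis) = mesh_cube \<delta> n"
  by (rule mesh_cube_cong) simp

lemma corner_in_mesh_cube: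
  assumes "0 \<le> \<delta>"
  shows "(\<Sum>b\<in>Basis. (of_int (n b) * \<delta>) *\<^sub>R b) \<in> mesh_cube \<delta> n"
  using assms by (simp add: mesh_cube_def algebra_simps)

text \<open>Each of two equal cubes contains the lowest corner of the other, which gives both
  inequalities between the indices.\<close>

lemma mesh_cube_inject:
  fixes n m :: "'a::euclidean_space \<Rightarrow> int"
  assumes "0 < \<delta>" and "mesh_cube \<delta> n = mesh_cube \<delta> m" and "b \<in> Basis"
  shows "n b = m b"
proof -
  have "of_int (m b) * \<delta> \<le> of_int (n b) * \<delta>"
    using corner_in_mesh_cube[of \<delta> n] assms by (auto simp: mesh_cube_def[of \<delta> m])
  moreover have "of_int (n b) * \<delta> \<le> of_int (m b) * \<delta>"
    using corner_in_mesh_cube[of \<delta> m] assms(1,3) unfolding assms(2)[symmetric]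
    by (auto simp: mesh_cube_def[of \<delta> n])
  ultimately show ?thesis using \<open>0 < \<delta>\<close> by simp
qed

lemma floor_bounds:
  fixes t \<delta> :: real
  assumes "0 < \<delta>"
  shows "of_int \<lfloor>t / \<delta>\<rfloor> * \<delta> \<le> t" "t < (of_int \<lfloor>t / \<delta>\<rfloor> + 1) * \<delta>"
proof -
  have "of_int \<lfloor>t / \<delta>\<rfloor> \<le> t / \<delta>" "t / \<delta> < of_int \<lfloor>t / \<delta>\<rfloor> + 1"
    by linarith+
  then show "of_int \<lfloor>t / \<delta>\<rfloor> * \<delta> \<le> t" "t < (of_int \<lfloor>t / \<delta>\<rfloor> + 1) * \<delta>"
    by (simp_all only: pos_le_divide_eq[OF assms] pos_divide_less_eq[OF assms])
qed

lemma in_floor_mesh_cube: "0 < \<delta> \<Longrightarrow> p \<in> mesh_cube \<delta> (\<lambda>b. \<lfloor>(p \<bullet> b) / \<delta>\<rfloor>)"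
  by (auto simp: mesh_cube_def floor_bounds less_imp_le)


text \<open>A cube that meets a mesh cube of at most the same side length has in every coordinate one of
  three consecutive indices.\<close>

lemma box_count_le_cover:
  fixes F :: "'a::euclidean_space set"
  assumes \<delta>: "0 < \<delta>'" "\<delta>' \<le> \<delta>"
    and fin: "finite \<Q>" and \<Q>: "\<Q> \<subseteq> range (mesh_cube \<delta>')" and F: "F \<subseteq> \<Union>\<Q>"
  shows "finite {Q. (\<exists>n. Q = mesh_cube \<delta> n) \<and> Q \<inter> F \<noteq> {}}"
    and "box_count \<delta> F \<le> 3 ^ DIM('a) * card \<Q>"
proof -
  let ?H = "{Q. (\<exists>n. Q = mesh_cube \<delta> n) \<and> Q \<inter> F \<noteq> {}}"
  define j where "j n b = \<lfloor>of_int (n b) * \<delta>' / \<delta>\<rfloor>" for n :: "'a \<Rightarrow> int" and b :: 'a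
  define B where "B n = (\<Pi>\<^sub>E b\<in>(Basis :: 'a set). {j n b - 1..j n b + 1})" for n
  \<comment> \<open>\<open>mesh_cube\<close> is not injective on all index functions, so
    \<open>I\<close> holds one index for each cube of \<open>\<Q>\<close> and the count stays at
    \<open>card \<Q>\<close>.\<close>
  obtain I where inj: "inj_on (mesh_cube \<delta>') I" and I: "\<Q> = mesh_cube \<delta>' ` I"
    using \<Q> subset_image_inj[of \<Q> "mesh_cube \<delta>'" UNIV] by auto
  have finI: "finite I" and card_I: "card I = card \<Q>"
    using fin inj by (auto simp: I finite_image_iff card_image)
  have finB: "finite (B n)" for n
    unfolding B_def by (intro finite_PiE) auto
  have cardB: "card (B n) = 3 ^ DIM('a)" for n
    unfolding B_def by (subst card_PiE) auto
  have sub: "?H \<subseteq> (\<Union>n\<in>I. mesh_cube \<delta> ` B n)"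
  proof
    fix Q assume "Q \<in> ?H"
    then obtain n p where Q: "Q = mesh_cube \<delta> n" and pQ: "p \<in> Q" and pF: "p \<in> F" by blast
    from pF F obtain n' where n': "n' \<in> I" "p \<in> mesh_cube \<delta>' n'" unfolding I by auto
    have "restrict n Basis \<in> B n'"
      unfolding B_def
    proof (intro restrict_PiE_iff[THEN iffD2] ballI)
      fix b :: 'a assume b: "b \<in> Basis"
      let ?x = "of_int (n' b) * \<delta>' / \<delta>"
      have pQ': "of_int (n b) * \<delta> \<le> p \<bullet> b" "p \<bullet> b \<le> (of_int (n b) + 1) * \<delta>"
        using pQ b unfolding Q mesh_cube_def by auto
      have pn: "of_int (n' b) * \<delta>' \<le> p \<bullet> b" "p \<bullet> b \<le> of_int (n' b) * \<delta>' + \<delta>"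
        using n'(2) b \<delta> unfolding mesh_cube_def by (auto simp: algebra_simps)
      have x: "?x * \<delta> = of_int (n' b) * \<delta>'" using \<delta> by simp
      have "of_int (n b) * \<delta> \<le> (?x + 1) * \<delta>" "?x * \<delta> \<le> (of_int (n b) + 1) * \<delta>"
        using pQ' pn x by (simp_all add: distrib_right)
      then have "of_int (n b) \<le> ?x + 1" "?x \<le> of_int (n b) + 1"
        using \<delta> by (simp_all only: mult_le_cancel_right_pos)
      then show "n b \<in> {j n' b - 1..j n' b + 1}"
        unfolding j_def by simp linarith
    qed
    then have "Q \<in> mesh_cube \<delta> ` B n'"
      unfolding Q by (subst mesh_cube_restrict[symmetric]) (rule imageI)
    then show "Q \<in> (\<Union>n\<in>I. mesh_cube \<delta> ` B n)" using n'(1) by blast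
  qed
  have finU: "finite (\<Union>n\<in>I. mesh_cube \<delta> ` B n)"
    using finI finB by auto
  show "finite ?H" by (rule finite_subset[OF sub finU])
  have "card ?H \<le> card (\<Union>n\<in>I. mesh_cube \<delta> ` B n)"
    by (rule card_mono[OF finU sub])
  also have "\<dots> \<le> (\<Sum>n\<in>I. card (mesh_cube \<delta> ` B n))"
    by (rule card_UN_le[OF finI])
  also have "\<dots> \<le> (\<Sum>n\<in>I. 3 ^ DIM('a))"
    using card_image_le[OF finB, of "mesh_cube \<delta>"] by (intro sum_mono) (simp add: cardB)
  finally show "box_count \<delta> F \<le> 3 ^ DIM('a) * card \<Q>"
    by (simp add: box_count_def card_I mult.commute)
qed

lemma finite_mesh_cubes_meeting:
  fixes F :: "'a::euclidean_space set"
  assumes "bounded F" and \<delta>: "0 < \<delta>"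
  shows "finite {Q. (\<exists>n. Q = mesh_cube \<delta> n) \<and> Q \<inter> F \<noteq> {}}"
proof -
  obtain M where M: "\<And>x. x \<in> F \<Longrightarrow> norm x \<le> M"
    using assms(1) by (auto simp: bounded_iff)
  let ?I = "(Basis :: 'a set) \<rightarrow>\<^sub>E {\<lfloor>- M / \<delta>\<rfloor>..\<lfloor>M / \<delta>\<rfloor>}"
  have "F \<subseteq> \<Union>(mesh_cube \<delta> ` ?I)"
  proof
    fix p assume p: "p \<in> F"
    have "restrict (\<lambda>b. \<lfloor>(p \<bullet> b) / \<delta>\<rfloor>) Basis \<in> ?I"
    proof (intro restrict_PiE_iff[THEN iffD2] ballI)
      fix b :: 'a assume "b \<in> Basis"
      then have "\<bar>p \<bullet> b\<bar> \<le> M" using Basis_le_norm[of b p] M[OF p] by linarith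
      then show "\<lfloor>(p \<bullet> b) / \<delta>\<rfloor> \<in> {\<lfloor>- M / \<delta>\<rfloor>..\<lfloor>M / \<delta>\<rfloor>}"
        using \<delta> divide_right_mono[of "- M" "p \<bullet> b" \<delta>] divide_right_mono[of "p \<bullet> b" M \<delta>]
        by (simp add: floor_mono abs_le_iff)
    qed
    moreover have "p \<in> mesh_cube \<delta> (restrict (\<lambda>b. \<lfloor>(p \<bullet> b) / \<delta>\<rfloor>) Basis)"
      using in_floor_mesh_cube[OF \<delta>] by (simp add: mesh_cube_restrict)
    ultimately show "p \<in> \<Union>(mesh_cube \<delta> ` ?I)" by blast
  qed
  \<comment> \<open>The floor indices miss cubes that touch \<open>F\<close> only along a face. The
    covering lemma at equal scales captures those as well.\<close>
  then show ?thesis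
    by (intro box_count_le_cover(1)[OF \<delta> order.refl]) (auto intro!: finite_PiE)
qed

lemma box_count_pos:
  assumes "bounded F" "0 < \<delta>" "F \<noteq> {}"
  shows "0 < box_count \<delta> F"
proof -
  obtain p where "p \<in> F" using assms by blast
  then have "mesh_cube \<delta> (\<lambda>b. \<lfloor>(p \<bullet> b) / \<delta>\<rfloor>) \<inter> F \<noteq> {}"
    using in_floor_mesh_cube[OF assms(2)] by blast
  then show ?thesis
    unfolding box_count_def using finite_mesh_cubes_meeting[OF assms(1,2)]
    by (auto simp: card_gt_0_iff)
qed

text \<open>The fine cubes that meet \<open>F\<close> cover it, so the covering lemma applies to
  them. This later transfers bounds from dyadic scales to all scales.\<close>

lemma box_count_mono_scale:
  fixes F :: "'a::euclidean_space set"
  assumes "bounded F" "0 < \<delta>'" "\<delta>' \<le> \<delta>"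
  shows "box_count \<delta> F \<le> 3 ^ DIM('a) * box_count \<delta>' F"
  unfolding box_count_def[of \<delta>']
proof (rule box_count_le_cover(2)[OF assms(2,3) finite_mesh_cubes_meeting[OF assms(1,2)]])
  show "F \<subseteq> \<Union>{Q. (\<exists>n. Q = mesh_cube \<delta>' n) \<and> Q \<inter> F \<noteq> {}}"
    using in_floor_mesh_cube[OF assms(2)] by blast
qed blast

section \<open>Oscillation sums over the unit mesh\<close>

lemma pt_inner_bounds: "b \<in> Basis \<Longrightarrow> 0 \<le> pt x \<bullet> b" "b \<in> Basis \<Longrightarrow> pt x \<bullet> b \<le> 1"
  using pt[of x] by (auto simp: Basis_vec_def inner_axis)

lemma exists_pt:
  fixes p :: "real ^ 'd::finite"
  assumes "\<And>b. b \<in> Basis \<Longrightarrow> 0 \<le> p \<bullet> b \<and> p \<bullet> b \<le> 1"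
  obtains x :: "'d unit_cube" where "pt x = p"
proof
  have "0 \<le> p $ i \<and> p $ i \<le> 1" for i
    using assms[of "axis i 1"] by (simp add: inner_axis)
  then show "pt (Abs_unit_cube p) = p" by (simp add: Abs_unit_cube_inverse)
qed

lemma continuous_on_pt: "continuous_on A pt"
  unfolding continuous_on_iff dist_unit_cube_def by blast

section \<open>Cubes of the unit mesh\<close>

definition mesh_index :: "real \<Rightarrow> (real ^ 'd::finite \<Rightarrow> int) set"
  where "mesh_index \<delta> = Basis \<rightarrow>\<^sub>E {0..\<lceil>1 / \<delta>\<rceil> - 1}"

lemma finite_mesh_index: "finite (mesh_index \<delta>)"
  unfolding mesh_index_def by (intro finite_PiE) auto

lemma unit_mesh_eq_image: "unit_mesh \<delta> = mesh_cube \<delta> ` mesh_index \<delta>"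
proof (intro equalityI subsetI)
  fix S :: "(real ^ 'a) set" assume "S \<in> unit_mesh \<delta>"
  then obtain n where n: "\<And>b. b \<in> Basis \<Longrightarrow> 0 \<le> n b \<and> n b \<le> \<lceil>1 / \<delta>\<rceil> - 1" "S = mesh_cube \<delta> n"
    unfolding unit_mesh_def by blast
  then have "restrict n Basis \<in> mesh_index \<delta>" by (auto simp: mesh_index_def)
  then show "S \<in> mesh_cube \<delta> ` mesh_index \<delta>"
    unfolding n(2) by (subst mesh_cube_restrict[symmetric]) (rule imageI)
next
  fix S :: "(real ^ 'a) set" assume "S \<in> mesh_cube \<delta> ` mesh_index \<delta>"
  then obtain n where n: "n \<in> mesh_index \<delta>" "S = mesh_cube \<delta> n" by blast
  then have "\<forall>b\<in>Basis. 0 \<le> n b \<and> n b \<le> \<lceil>1 / \<delta>\<rceil> - 1" by (simp add: mesh_index_def PiE_iff)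
  with n(2) show "S \<in> unit_mesh \<delta>"
    unfolding unit_mesh_def by (intro CollectI exI conjI)
qed

lemma finite_unit_mesh: "finite (unit_mesh \<delta>)"
  unfolding unit_mesh_eq_image using finite_mesh_index by blast

lemma card_unit_mesh:
  assumes "0 < \<delta>"
  shows "card (unit_mesh \<delta> :: (real ^ 'd::finite) set set) = nat \<lceil>1 / \<delta>\<rceil> ^ CARD('d)"
proof -
  have "inj_on (mesh_cube \<delta>) (mesh_index \<delta> :: (real ^ 'd \<Rightarrow> int) set)"
    unfolding mesh_index_def using mesh_cube_inject[OF assms] by (intro inj_onI PiE_ext) auto
  then have "card (unit_mesh \<delta> :: (real ^ 'd) set set) = card (mesh_index \<delta> :: (real ^ 'd \<Rightarrow> int) set)"
    unfolding unit_mesh_eq_image by (rule card_image)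
  also have "\<dots> = nat \<lceil>1 / \<delta>\<rceil> ^ CARD('d)"
    unfolding mesh_index_def by (subst card_PiE) auto
  finally show ?thesis .
qed

lemma card_unit_mesh_ge:
  assumes "0 < \<delta>"
  shows "\<delta> powr - real CARD('d) \<le> real (card (unit_mesh \<delta> :: (real ^ 'd::finite) set set))"
proof -
  have "\<delta> powr - real CARD('d) = (1 / \<delta>) ^ CARD('d)"
    using assms by (simp add: powr_minus powr_realpow power_one_over divide_inverse power_inverse)
  also have "\<dots> \<le> real (nat \<lceil>1 / \<delta>\<rceil>) ^ CARD('d)"
    using assms by (intro power_mono) auto
  finally show ?thesis by (simp add: card_unit_mesh[OF assms])
qed

lemma card_unit_mesh_le:
  assumes "0 < \<delta>" "\<delta> \<le> 1"
  shows "real (card (unit_mesh \<delta> :: (real ^ 'd::finite) set set)) \<le> 2 ^ CARD('d) * \<delta> powr - real CARD('d)"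
proof -
  have "1 \<le> 1 / \<delta>" using assms by simp
  then have "real (nat \<lceil>1 / \<delta>\<rceil>) \<le> 2 * (1 / \<delta>)" by linarith
  then have "real (nat \<lceil>1 / \<delta>\<rceil>) ^ CARD('d) \<le> (2 * (1 / \<delta>)) ^ CARD('d)"
    by (intro power_mono) auto
  also have "\<dots> = 2 ^ CARD('d) * \<delta> powr - real CARD('d)"
    using assms by (simp add: powr_minus powr_realpow power_divide divide_inverse power_inverse power_mult_distrib)
  finally show ?thesis by (simp add: card_unit_mesh[OF assms(1)])
qed

lemma unit_mesh_cover:
  fixes x :: "'d::finite unit_cube"
  assumes "0 < \<delta>"
  obtains S where "S \<in> unit_mesh \<delta>" "pt x \<in> S"
proof
  \<comment> \<open>The minimum matters on the far face: if a coordinate is 1 and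
    \<open>1 / \<delta>\<close> is an integer, the floor is one past the last index.\<close>
  let ?n = "\<lambda>b. min \<lfloor>(pt x \<bullet> b) / \<delta>\<rfloor> (\<lceil>1 / \<delta>\<rceil> - 1)"
  have pos: "0 < \<lceil>1 / \<delta>\<rceil>" using assms by simp
  show "mesh_cube \<delta> ?n \<in> unit_mesh \<delta>"
    unfolding unit_mesh_def using pos assms pt_inner_bounds(1)[of _ x] by (auto intro!: exI[of _ ?n])
  show "pt x \<in> mesh_cube \<delta> ?n"
    unfolding mesh_cube_def
  proof (intro CollectI ballI)
    fix b :: "real ^ 'd" assume b: "b \<in> Basis"
    have f: "of_int \<lfloor>(pt x \<bullet> b) / \<delta>\<rfloor> * \<delta> \<le> pt x \<bullet> b"
      "pt x \<bullet> b < (of_int \<lfloor>(pt x \<bullet> b) / \<delta>\<rfloor> + 1) * \<delta>"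
      using floor_bounds[OF assms] by auto
    have "of_int (?n b) * \<delta> \<le> of_int \<lfloor>(pt x \<bullet> b) / \<delta>\<rfloor> * \<delta>"
      using assms by (intro mult_right_mono) auto
    moreover have "pt x \<bullet> b \<le> of_int \<lceil>1 / \<delta>\<rceil> * \<delta>"
    proof -
      have "1 / \<delta> \<le> of_int \<lceil>1 / \<delta>\<rceil>" by simp
      then have "1 \<le> of_int \<lceil>1 / \<delta>\<rceil> * \<delta>" using assms by (simp only: pos_divide_le_eq)
      then show ?thesis using pt_inner_bounds(2)[OF b, of x] by linarith
    qed
    ultimately show "of_int (?n b) * \<delta> \<le> pt x \<bullet> b \<and> pt x \<bullet> b \<le> (of_int (?n b) + 1) * \<delta>"
      using f by (auto simp: min_def)
  qed
qed

text \<open>When \<open>1 / \<delta>\<close> is not an integer the last cubes stick out of the unit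
  cube, but every lowest corner lies in it because \<open>n b < 1 / \<delta>\<close>. Hence no
  oscillation over the unit mesh is a supremum over the empty set.\<close>

lemma unit_mesh_corner:
  assumes "0 < \<delta>" "n \<in> mesh_index \<delta>"
  obtains x :: "'d::finite unit_cube"
  where "pt x = (\<Sum>b\<in>Basis. (of_int (n b) * \<delta>) *\<^sub>R b)" "pt x \<in> mesh_cube \<delta> n"
proof -
  let ?p = "\<Sum>b\<in>Basis. (of_int (n b) * \<delta>) *\<^sub>R b :: real ^ 'd"
  have "0 \<le> ?p \<bullet> b \<and> ?p \<bullet> b \<le> 1" if b: "b \<in> Basis" for b
  proof -
    have n: "0 \<le> n b" "n b \<le> \<lceil>1 / \<delta>\<rceil> - 1" using assms(2) b by (auto simp: mesh_index_def)
    then have "of_int (n b) \<le> 1 / \<delta>" by linarith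
    then have "of_int (n b) * \<delta> \<le> 1" using assms(1) by (simp only: pos_le_divide_eq)
    then show ?thesis using b n assms(1) by simp
  qed
  then obtain x :: "'d unit_cube" where "pt x = ?p" using exists_pt by blast
  then show thesis using that corner_in_mesh_cube[of \<delta> n] assms(1) by auto
qed

lemma unit_mesh_nonempty:
  fixes S :: "(real ^ 'd::finite) set"
  assumes "0 < \<delta>" "S \<in> unit_mesh \<delta>"
  obtains x :: "'d unit_cube" where "pt x \<in> S"
proof -
  obtain n where n: "n \<in> mesh_index \<delta>" "S = mesh_cube \<delta> n"
    using assms(2) unfolding unit_mesh_eq_image by blast
  then show thesis using unit_mesh_corner[OF assms(1) n(1)] that by blast
qed

section \<open>Oscillation on a single cube\<close>

lemma abs_diff_le_oscillation:
  fixes f :: "'d::finite unit_cube \<Rightarrow>\<^sub>C real"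
  assumes "pt x \<in> S" "pt y \<in> S"
  shows "\<bar>f x - f y\<bar> \<le> oscillation f S"
  unfolding oscillation_def
proof (rule cSup_upper)
  show "bdd_above {\<bar>f x - f y\<bar> | x y. pt x \<in> S \<and> pt y \<in> S}"
  proof (rule bdd_aboveI)
    fix r assume "r \<in> {\<bar>f x - f y\<bar> | x y. pt x \<in> S \<and> pt y \<in> S}"
    then obtain x y where r: "r = \<bar>f x - f y\<bar>" by blast
    show "r \<le> 2 * norm f" using norm_bounded[of f x] norm_bounded[of f y] unfolding r by simp
  qed
qed (use assms in blast)

text \<open>The real supremum of an empty set carries no information, so a point of the unit cube in
  \<open>S\<close> has to be supplied before the supremum can be bounded.\<close>

lemma oscillation_le:
  fixes f :: "'d::finite unit_cube \<Rightarrow>\<^sub>C real"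
  assumes "0 < \<delta>" "S \<in> unit_mesh \<delta>"
    and "\<And>x y. pt x \<in> S \<Longrightarrow> pt y \<in> S \<Longrightarrow> \<bar>f x - f y\<bar> \<le> B"
  shows "oscillation f S \<le> B"
proof -
  obtain x :: "'d unit_cube" where "pt x \<in> S" using unit_mesh_nonempty[OF assms(1,2)] .
  then show ?thesis unfolding oscillation_def using assms(3) by (intro cSup_least) auto
qed

lemma oscillation_nonneg:
  fixes f :: "'d::finite unit_cube \<Rightarrow>\<^sub>C real"
  assumes "0 < \<delta>" "S \<in> unit_mesh \<delta>"
  shows "0 \<le> oscillation f S"
proof -
  obtain x :: "'d unit_cube" where "pt x \<in> S" using unit_mesh_nonempty[OF assms] .
  from abs_diff_le_oscillation[OF this this] show ?thesis by simp
qed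

lemma oscillation_add:
  fixes f g :: "'d::finite unit_cube \<Rightarrow>\<^sub>C real"
  assumes "0 < \<delta>" "S \<in> unit_mesh \<delta>"
  shows "oscillation (f + g) S \<le> oscillation f S + oscillation g S"
proof (rule oscillation_le[OF assms])
  fix x y assume "pt x \<in> S" "pt y \<in> S"
  then show "\<bar>(f + g) x - (f + g) y\<bar> \<le> oscillation f S + oscillation g S"
    using abs_diff_le_oscillation[of x S y f] abs_diff_le_oscillation[of x S y g]
    by (simp add: plus_bcontfun.rep_eq)
qed

lemma oscillation_scaleR_le:
  fixes f :: "'d::finite unit_cube \<Rightarrow>\<^sub>C real"
  assumes "0 < \<delta>" "S \<in> unit_mesh \<delta>"
  shows "oscillation (c *\<^sub>R f) S \<le> \<bar>c\<bar> * oscillation f S"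
proof (rule oscillation_le[OF assms])
  fix x y assume "pt x \<in> S" "pt y \<in> S"
  then show "\<bar>(c *\<^sub>R f) x - (c *\<^sub>R f) y\<bar> \<le> \<bar>c\<bar> * oscillation f S"
    using abs_diff_le_oscillation[of x S y f]
    by (simp add: scaleR_bcontfun.rep_eq abs_mult mult_left_mono flip: right_diff_distrib)
qed

section \<open>The oscillation sum as a seminorm\<close>

definition osc_sum :: "real \<Rightarrow> ('d::finite unit_cube \<Rightarrow>\<^sub>C real) \<Rightarrow> real"
  where "osc_sum \<delta> f = (\<Sum>S\<in>unit_mesh \<delta>. oscillation f S)"

lemma osc_sum_nonneg: "0 < \<delta> \<Longrightarrow> 0 \<le> osc_sum \<delta> f"
  unfolding osc_sum_def by (intro sum_nonneg oscillation_nonneg)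

lemma osc_sum_add: "0 < \<delta> \<Longrightarrow> osc_sum \<delta> (f + g) \<le> osc_sum \<delta> f + osc_sum \<delta> g"
  unfolding osc_sum_def sum.distrib[symmetric] by (intro sum_mono oscillation_add)

lemma osc_sum_scaleR_le: "0 < \<delta> \<Longrightarrow> osc_sum \<delta> (c *\<^sub>R f) \<le> \<bar>c\<bar> * osc_sum \<delta> f"
  unfolding osc_sum_def sum_distrib_left by (intro sum_mono oscillation_scaleR_le)

text \<open>For nonzero \<open>c\<close> the reverse inequality is the bound for multiples applied
  to \<open>inverse c\<close> and \<open>c *\<^sub>R f\<close>.\<close>

lemma osc_sum_scaleR:
  assumes "0 < \<delta>"
  shows "osc_sum \<delta> (c *\<^sub>R f) = \<bar>c\<bar> * osc_sum \<delta> f"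
proof (cases "c = 0")
  case True
  then show ?thesis using osc_sum_scaleR_le[OF assms, of c f] osc_sum_nonneg[OF assms, of "c *\<^sub>R f"] by simp
next
  case False
  have "osc_sum \<delta> f \<le> \<bar>inverse c\<bar> * osc_sum \<delta> (c *\<^sub>R f)"
    using osc_sum_scaleR_le[OF assms, of "inverse c" "c *\<^sub>R f"] False by simp
  then have "\<bar>c\<bar> * osc_sum \<delta> f \<le> osc_sum \<delta> (c *\<^sub>R f)"
    using False by (simp add: field_simps)
  then show ?thesis using osc_sum_scaleR_le[OF assms, of c f] by simp
qed

lemma osc_sum_le:
  fixes f :: "'d::finite unit_cube \<Rightarrow>\<^sub>C real"
  assumes "0 < \<delta>" "\<delta> \<le> 1" "0 \<le> B"
    and "\<And>S x y. S \<in> unit_mesh \<delta> \<Longrightarrow> pt x \<in> S \<Longrightarrow> pt y \<in> S \<Longrightarrow> \<bar>f x - f y\<bar> \<le> B"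
  shows "osc_sum \<delta> f \<le> 2 ^ CARD('d) * \<delta> powr - real CARD('d) * B"
proof -
  have "osc_sum \<delta> f \<le> (\<Sum>S\<in>(unit_mesh \<delta> :: (real ^ 'd) set set). B)"
    unfolding osc_sum_def using assms by (intro sum_mono oscillation_le[OF assms(1)]) auto
  also have "\<dots> = real (card (unit_mesh \<delta> :: (real ^ 'd) set set)) * B" by simp
  also have "\<dots> \<le> 2 ^ CARD('d) * \<delta> powr - real CARD('d) * B"
    using assms card_unit_mesh_le by (intro mult_right_mono) auto
  finally show ?thesis .
qed

lemma osc_sum_ge:
  fixes f :: "'d::finite unit_cube \<Rightarrow>\<^sub>C real"
  assumes "0 < \<delta>" "0 \<le> B" and "\<And>S. S \<in> unit_mesh \<delta> \<Longrightarrow> B \<le> oscillation f S"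
  shows "\<delta> powr - real CARD('d) * B \<le> osc_sum \<delta> f"
proof -
  have "\<delta> powr - real CARD('d) * B \<le> real (card (unit_mesh \<delta> :: (real ^ 'd) set set)) * B"
    using assms card_unit_mesh_ge by (intro mult_right_mono) auto
  also have "\<dots> = (\<Sum>S\<in>(unit_mesh \<delta> :: (real ^ 'd) set set). B)" by simp
  also have "\<dots> \<le> osc_sum \<delta> f"
    unfolding osc_sum_def using assms by (intro sum_mono) auto
  finally show ?thesis .
qed

section \<open>Box counts of graphs\<close>

text \<open>A basis vector of the product is \<open>(u, 0)\<close> or \<open>(0, 1)\<close>, and
  \<open>snd b = 0\<close> tells the two apart. The index function is thus \<open>n\<close> in the
  horizontal directions and \<open>m\<close> in the vertical one.\<close>

lemma mesh_cube_column:
  fixes n :: "real ^ 'd::finite \<Rightarrow> int"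
  shows "mesh_cube \<delta> n \<times> {of_int m * \<delta>..(of_int m + 1) * \<delta>} =
    mesh_cube \<delta> (\<lambda>b :: (real ^ 'd) \<times> real. if snd b = 0 then n (fst b) else m)"
  by (auto simp: mesh_cube_def Basis_prod_def)

lemma bounded_graph: "bounded (graph f)"
proof -
  have "bounded (range pt)"
    by (intro compact_imp_bounded compact_continuous_image continuous_on_pt compact_UNIV_unit_cube)
  moreover have "bounded (range (apply_bcontfun f))"
    by (simp add: bounded_apply_bcontfun)
  ultimately have "bounded (range pt \<times> range (apply_bcontfun f))"
    by (rule bounded_Times)
  then show ?thesis by (rule bounded_subset) (auto simp: graph_def)
qed

lemma graph_nonempty: "graph f \<noteq> {}"
  by (auto simp: graph_def)

text \<open>The part of a mesh cube in the unit cube is convex, and \<open>Abs_unit_cube\<close>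
  preserves distances on it. Connectedness is what the intermediate value argument on a single cube
  requires.\<close>

lemma connected_mesh_cube_points:
  fixes n :: "real ^ 'd::finite \<Rightarrow> int"
  shows "connected {x :: 'd unit_cube. pt x \<in> mesh_cube \<delta> n}"
proof -
  let ?C = "mesh_cube \<delta> n \<inter> {x. \<forall>i. 0 \<le> x $ i \<and> x $ i \<le> 1}"
  have C: "{x :: real ^ 'd. \<forall>i. 0 \<le> x $ i \<and> x $ i \<le> 1} = cbox 0 1"
    by (auto simp: mem_box_cart)
  have "connected ?C"
    unfolding C by (intro convex_connected convex_Int convex_mesh_cube convex_box)
  moreover have "continuous_on ?C (Abs_unit_cube :: real ^ 'd \<Rightarrow> 'd unit_cube)"
    unfolding continuous_on_iff
  proof (intro ballI allI impI)
    fix x :: "real ^ 'd" and e :: real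
    assume "x \<in> ?C" "0 < e"
    then show "\<exists>r>0. \<forall>x'\<in>?C. dist x' x < r \<longrightarrow> dist (Abs_unit_cube x') (Abs_unit_cube x) < e"
      by (intro exI[of _ e] conjI ballI impI) (simp_all only: dist_unit_cube_def Abs_unit_cube_inverse Int_iff)
  qed
  ultimately have "connected (Abs_unit_cube ` ?C :: 'd unit_cube set)"
    by (rule connected_continuous_image[rotated])
  also have "Abs_unit_cube ` ?C = {x :: 'd unit_cube. pt x \<in> mesh_cube \<delta> n}"
  proof (intro equalityI subsetI)
    fix x :: "'d unit_cube" assume "x \<in> {x. pt x \<in> mesh_cube \<delta> n}"
    then have "pt x \<in> ?C" using pt[of x] by simp
    then show "x \<in> Abs_unit_cube ` ?C" by (rule image_eqI[where x = "pt x", rotated]) (simp add: pt_inverse)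
  next
    fix x :: "'d unit_cube" assume "x \<in> Abs_unit_cube ` ?C"
    then obtain p where "p \<in> ?C" "x = Abs_unit_cube p" by blast
    then show "x \<in> {x. pt x \<in> mesh_cube \<delta> n}" by (simp add: Abs_unit_cube_inverse)
  qed
  finally show ?thesis .
qed

text \<open>By the intermediate value theorem the graph over a cube \<open>S\<close> meets every
  mesh cube in the column of \<open>S\<close> between two of its heights, so that column contributes
  at least \<open>oscillation f S / \<delta>\<close> cubes. Cubes of different columns are
  different, so these numbers add up.\<close>

lemma osc_sum_le_box_count:
  fixes f :: "'d::finite unit_cube \<Rightarrow>\<^sub>C real"
  assumes \<delta>: "0 < \<delta>"
  shows "osc_sum \<delta> f \<le> \<delta> * real (box_count \<delta> (graph f))"
proof -
  let ?Q = "{Q. (\<exists>n. Q = mesh_cube \<delta> n) \<and> Q \<inter> graph f \<noteq> {}}"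
  define J where "J m = {of_int m * \<delta>..(of_int m + 1) * \<delta>}" for m :: int
  define H where "H S = {m. \<exists>x. pt x \<in> S \<and> f x \<in> J m}" for S
  have fJ: "f x \<in> J \<lfloor>f x / \<delta>\<rfloor>" for x
    using floor_bounds[OF \<delta>, of "f x"] by (simp add: J_def)
  have J_ne: "J m \<noteq> {}" for m using \<delta> by (simp add: J_def algebra_simps)
  have J_inj: "m = m'" if "J m = J m'" for m m'
    using that \<delta> J_ne[of m] unfolding J_def by (simp add: Icc_eq_Icc)
  have column: "S \<times> J m \<in> ?Q" if S: "S \<in> unit_mesh \<delta>" and m: "m \<in> H S" for S m
  proof -
    obtain n where n: "S = mesh_cube \<delta> n" using S by (auto simp: unit_mesh_def)
    show ?thesis using m mesh_cube_column[of \<delta> n m]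
      unfolding H_def n J_def graph_def by blast
  qed
  have S_ne: "S \<noteq> {}" if "S \<in> unit_mesh \<delta>" for S :: "(real ^ 'd) set"
    using unit_mesh_nonempty[OF \<delta> that] by blast
  \<comment> \<open>A product of nonempty sets determines its factors, so no cube is counted for two
    pairs.\<close>
  have inj: "inj_on (\<lambda>(S, m). S \<times> J m) (Sigma (unit_mesh \<delta>) H)"
    using S_ne J_ne J_inj by (auto simp: inj_on_def times_eq_iff)
  have sub: "(\<lambda>(S, m). S \<times> J m) ` Sigma (unit_mesh \<delta>) H \<subseteq> ?Q"
    using column by auto
  have finQ: "finite ?Q"
    by (rule finite_mesh_cubes_meeting[OF bounded_graph \<delta>])
  have fin: "finite (Sigma (unit_mesh \<delta>) H)"
    using finite_imageD[OF finite_subset[OF sub finQ] inj] .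
  have card_le: "card (Sigma (unit_mesh \<delta>) H) \<le> box_count \<delta> (graph f)"
    unfolding box_count_def by (rule card_inj_on_le[OF inj sub finQ])
  have finH: "finite (H S)" if "S \<in> unit_mesh \<delta>" for S
  proof (rule finite_subset)
    show "H S \<subseteq> snd ` Sigma (unit_mesh \<delta>) H" using that by force
  qed (use fin in blast)
  have osc: "oscillation f S \<le> \<delta> * real (card (H S))" if S: "S \<in> unit_mesh \<delta>" for S
  proof (rule oscillation_le[OF \<delta> S])
    have le: "f y - f x \<le> \<delta> * real (card (H S))"
      if x: "pt x \<in> S" and y: "pt y \<in> S" and xy: "f x \<le> f y" for x y
    proof -
      obtain n where n: "S = mesh_cube \<delta> n" using S by (auto simp: unit_mesh_def)
      have "connected (apply_bcontfun f ` {x. pt x \<in> S})"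
        unfolding n by (intro connected_continuous_image connected_mesh_cube_points)
          (simp add: continuous_on_apply_bcontfun)
      then have conn: "\<exists>z. pt z \<in> S \<and> f z = t" if "f x \<le> t" "t \<le> f y" for t
      proof -
        have "t \<in> apply_bcontfun f ` {x. pt x \<in> S}"
          using \<open>connected _\<close>[unfolded connected_iff_interval] that x y by blast
        then show ?thesis by blast
      qed
      have "{\<lfloor>f x / \<delta>\<rfloor>..\<lfloor>f y / \<delta>\<rfloor>} \<subseteq> H S"
      proof
        fix m assume m: "m \<in> {\<lfloor>f x / \<delta>\<rfloor>..\<lfloor>f y / \<delta>\<rfloor>}"
        show "m \<in> H S"
        \<comment> \<open>For the lowest index the height \<open>f x\<close> itself is the witness,
          since \<open>of_int m * \<delta>\<close> may lie below it. For all larger indices the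
          bottom height \<open>of_int m * \<delta>\<close> lies between \<open>f x\<close> and
          \<open>f y\<close> and is attained.\<close>
        proof (cases "m = \<lfloor>f x / \<delta>\<rfloor>")
          case True
          then show ?thesis
            unfolding H_def using x fJ by blast
        next
          case False
          then have "\<lfloor>f x / \<delta>\<rfloor> + 1 \<le> m" using m by auto
          then have "f x / \<delta> \<le> of_int m" "of_int m \<le> f y / \<delta>" using m by (simp_all add: le_floor_iff) linarith
          then have "f x \<le> of_int m * \<delta>" "of_int m * \<delta> \<le> f y"
            using \<delta> by (simp_all only: pos_divide_le_eq pos_le_divide_eq)
          then obtain z where "pt z \<in> S" "f z = of_int m * \<delta>" using conn by blast
          then show ?thesis
            unfolding H_def J_def using \<delta> by (auto intro!: exI[of _ z] simp: algebra_simps)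
        qed
      qed
      then have "card {\<lfloor>f x / \<delta>\<rfloor>..\<lfloor>f y / \<delta>\<rfloor>} \<le> card (H S)"
        by (rule card_mono[OF finH[OF S]])
      \<comment> \<open>The integer interval has one element more than the difference of the floors,
        which makes up for the rounding.\<close>
      then have "f y / \<delta> - f x / \<delta> \<le> real (card (H S))"
        by simp linarith
      then show ?thesis using \<delta> by (simp add: field_simps)
    qed
    show "\<bar>f x - f y\<bar> \<le> \<delta> * real (card (H S))" if "pt x \<in> S" "pt y \<in> S" for x y
      using le[of x y] le[of y x] that by (cases "f x \<le> f y") auto
  qed
  have card_Sigma: "card (Sigma (unit_mesh \<delta>) H) = (\<Sum>S\<in>unit_mesh \<delta>. card (H S))"
    by (intro card_SigmaI finite_unit_mesh ballI finH)
  have "osc_sum \<delta> f \<le> (\<Sum>S\<in>unit_mesh \<delta>. \<delta> * real (card (H S)))"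
    unfolding osc_sum_def by (intro sum_mono osc)
  also have "\<dots> = \<delta> * real (card (Sigma (unit_mesh \<delta>) H))"
    by (simp add: card_Sigma sum_distrib_left)
  also have "\<dots> \<le> \<delta> * real (box_count \<delta> (graph f))"
    using card_le \<delta> by simp
  finally show ?thesis .
qed

text \<open>Over \<open>S\<close> the graph stays within \<open>oscillation f S\<close> of its
  height at one chosen point. It therefore fits into at most
  \<open>2 * oscillation f S / \<delta> + 2\<close> cubes of the column, the 2 coming from rounding
  at both ends. The factor \<open>3 ^ (CARD('d) + 1)\<close> accounts for cubes that touch the graph
  without belonging to this cover.\<close>

lemma box_count_le_osc_sum:
  fixes f :: "'d::finite unit_cube \<Rightarrow>\<^sub>C real"
  assumes \<delta>: "0 < \<delta>" "\<delta> \<le> 1"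
  shows "real (box_count \<delta> (graph f)) \<le>
    2 * 3 ^ (CARD('d) + 1) * (2 ^ CARD('d) * \<delta> powr - real CARD('d) + osc_sum \<delta> f / \<delta>)"
proof -
  define J where "J m = {of_int m * \<delta>..(of_int m + 1) * \<delta>}" for m :: int
  define p where "p S = (SOME x :: 'd unit_cube. pt x \<in> S)" for S
  define A where "A S = {\<lfloor>(f (p S) - oscillation f S) / \<delta>\<rfloor>..\<lfloor>(f (p S) + oscillation f S) / \<delta>\<rfloor>}" for S
  let ?Q = "\<Union>S\<in>unit_mesh \<delta>. (\<lambda>m. S \<times> J m) ` A S"
  have p: "pt (p S) \<in> S" if S: "S \<in> unit_mesh \<delta>" for S
  proof -
    have "\<exists>x :: 'd unit_cube. pt x \<in> S" using unit_mesh_nonempty[OF \<delta>(1) S] by blast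
    then show ?thesis unfolding p_def by (rule someI_ex)
  qed
  have cardA: "real (card (A S)) \<le> 2 * oscillation f S / \<delta> + 2" if S: "S \<in> unit_mesh \<delta>" for S
  proof -
    have "0 \<le> oscillation f S" by (rule oscillation_nonneg[OF \<delta>(1) S])
    then have "(f (p S) - oscillation f S) / \<delta> \<le> (f (p S) + oscillation f S) / \<delta>"
      using \<delta> by (intro divide_right_mono) auto
    then have "real (card (A S)) \<le> (f (p S) + oscillation f S) / \<delta> - (f (p S) - oscillation f S) / \<delta> + 2"
      unfolding A_def by simp linarith
    also have "\<dots> = 2 * oscillation f S / \<delta> + 2" by (simp add: diff_divide_distrib add_divide_distrib)
    finally show ?thesis .
  qed
  have range: "?Q \<subseteq> range (mesh_cube \<delta>)"
  proof
    fix Q assume "Q \<in> ?Q"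
    then obtain S m where S: "S \<in> unit_mesh \<delta>" "Q = S \<times> J m" by blast
    then obtain n where "S = mesh_cube \<delta> n" by (auto simp: unit_mesh_def)
    then show "Q \<in> range (mesh_cube \<delta>)" using S(2) mesh_cube_column[of \<delta> n m] unfolding J_def by blast
  qed
  have cover: "graph f \<subseteq> \<Union>?Q"
  proof
    fix z assume "z \<in> graph f"
    then obtain x where z: "z = (pt x, f x)" by (auto simp: graph_def)
    obtain S where S: "S \<in> unit_mesh \<delta>" "pt x \<in> S" using unit_mesh_cover[OF \<delta>(1)] .
    have "\<bar>f x - f (p S)\<bar> \<le> oscillation f S" using abs_diff_le_oscillation[OF S(2) p[OF S(1)]] .
    then have "\<lfloor>f x / \<delta>\<rfloor> \<in> A S"
      unfolding A_def using \<delta> by (auto intro!: floor_mono divide_right_mono simp: abs_le_iff)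
    moreover have "f x \<in> J \<lfloor>f x / \<delta>\<rfloor>"
      unfolding J_def using floor_bounds[OF \<delta>(1), of "f x"] by simp
    ultimately show "z \<in> \<Union>?Q" using S z by blast
  qed
  have fin: "finite ?Q" using finite_unit_mesh by (auto simp: A_def)
  have "real (card ?Q) \<le> real (\<Sum>S\<in>unit_mesh \<delta>. card ((\<lambda>m. S \<times> J m) ` A S))"
    using card_UN_le[OF finite_unit_mesh] by (rule of_nat_mono)
  also have "\<dots> \<le> (\<Sum>S\<in>unit_mesh \<delta>. real (card (A S)))"
    unfolding of_nat_sum by (intro sum_mono of_nat_mono card_image_le) (simp add: A_def)
  also have "\<dots> \<le> (\<Sum>S\<in>unit_mesh \<delta>. 2 * oscillation f S / \<delta> + 2)"
    by (intro sum_mono cardA)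
  also have "\<dots> = 2 * osc_sum \<delta> f / \<delta> + 2 * real (card (unit_mesh \<delta> :: (real ^ 'd) set set))"
    by (simp add: sum.distrib osc_sum_def flip: sum_divide_distrib sum_distrib_left)
  also have "\<dots> \<le> 2 * osc_sum \<delta> f / \<delta> + 2 * (2 ^ CARD('d) * \<delta> powr - real CARD('d))"
    using card_unit_mesh_le[OF \<delta>, where 'd = 'd] by simp
  finally have card_Q: "real (card ?Q) \<le> 2 * (2 ^ CARD('d) * \<delta> powr - real CARD('d) + osc_sum \<delta> f / \<delta>)"
    by simp
  have "real (box_count \<delta> (graph f)) \<le> 3 ^ (CARD('d) + 1) * real (card ?Q)"
    using of_nat_mono[OF box_count_le_cover(2)[OF \<delta>(1) order.refl fin range cover]]
    by (simp add: of_nat_power)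
  also have "\<dots> \<le> 3 ^ (CARD('d) + 1) * (2 * (2 ^ CARD('d) * \<delta> powr - real CARD('d) + osc_sum \<delta> f / \<delta>))"
    using card_Q by (intro mult_left_mono) auto
  finally show ?thesis by (simp add: algebra_simps)
qed

section \<open>Box dimensions of graphs\<close>

lemma eventually_at_right_0_less:
  assumes "0 < (c :: real)"
  shows "\<forall>\<^sub>F \<delta> in at_right 0. 0 < \<delta> \<and> \<delta> < c"
  using assms by (auto simp: eventually_at_right_field)

section \<open>Box dimensions as growth rates of the box count\<close>

lemma log_quotient_le_iff:
  assumes "0 < \<delta>" "\<delta> < 1" "0 < (N :: real)"
  shows "ln N / (- ln \<delta>) \<le> t \<longleftrightarrow> N \<le> \<delta> powr - t"
proof -
  have "ln N / (- ln \<delta>) \<le> t \<longleftrightarrow> ln N \<le> t * (- ln \<delta>)"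
    using assms by (intro pos_divide_le_eq) simp
  also have "\<dots> \<longleftrightarrow> ln N \<le> ln (\<delta> powr - t)"
    using assms by (simp add: ln_powr)
  also have "\<dots> \<longleftrightarrow> N \<le> \<delta> powr - t"
    using assms by (intro ln_le_cancel_iff) auto
  finally show ?thesis .
qed

lemma le_log_quotient_iff:
  assumes "0 < \<delta>" "\<delta> < 1" "0 < (N :: real)"
  shows "t \<le> ln N / (- ln \<delta>) \<longleftrightarrow> \<delta> powr - t \<le> N"
proof -
  have "t \<le> ln N / (- ln \<delta>) \<longleftrightarrow> t * (- ln \<delta>) \<le> ln N"
    using assms by (intro pos_le_divide_eq) simp
  also have "\<dots> \<longleftrightarrow> ln (\<delta> powr - t) \<le> ln N"
    using assms by (simp add: ln_powr)
  also have "\<dots> \<longleftrightarrow> \<delta> powr - t \<le> N"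
    using assms by (intro ln_le_cancel_iff) auto
  finally show ?thesis .
qed

text \<open>For scales below 1 a bound on the logarithmic quotient is a power bound on the box
  count. The slack \<open>e\<close> expresses that an upper limit is at most \<open>a\<close> if and
  only if every larger number is eventually an upper bound.\<close>

lemma upper_box_dim_le_iff:
  assumes F: "bounded F" "F \<noteq> {}"
  shows "upper_box_dim F \<le> ereal a \<longleftrightarrow>
    (\<forall>e>0. \<forall>\<^sub>F \<delta> in at_right 0. real (box_count \<delta> F) \<le> \<delta> powr - (a + e))"
proof
  assume L: "upper_box_dim F \<le> ereal a"
  show "\<forall>e>0. \<forall>\<^sub>F \<delta> in at_right 0. real (box_count \<delta> F) \<le> \<delta> powr - (a + e)"
  proof (intro allI impI)
    fix e :: real assume "0 < e"
    then have "ereal a < ereal (a + e)" by simp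
    with L have "\<forall>\<^sub>F \<delta> in at_right 0. ereal (ln (real (box_count \<delta> F)) / (- ln \<delta>)) < ereal (a + e)"
      unfolding upper_box_dim_def Limsup_le_iff by blast
    then show "\<forall>\<^sub>F \<delta> in at_right 0. real (box_count \<delta> F) \<le> \<delta> powr - (a + e)"
      using eventually_at_right_0_less[OF zero_less_one]
    proof eventually_elim
      case (elim \<delta>)
      then have "ln (real (box_count \<delta> F)) / (- ln \<delta>) \<le> a + e" by simp
      then show ?case using elim box_count_pos[OF F(1) _ F(2), of \<delta>]
        by (subst (asm) log_quotient_le_iff) auto
    qed
  qed
next
  assume R: "\<forall>e>0. \<forall>\<^sub>F \<delta> in at_right 0. real (box_count \<delta> F) \<le> \<delta> powr - (a + e)"
  show "upper_box_dim F \<le> ereal a"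
    unfolding upper_box_dim_def Limsup_le_iff
  proof (intro allI impI)
    fix y assume "ereal a < y"
    then obtain r where r: "ereal a < ereal r" "ereal r < y" using ereal_dense2 by blast
    then have "\<forall>\<^sub>F \<delta> in at_right 0. real (box_count \<delta> F) \<le> \<delta> powr - (a + (r - a))"
      using r(1) by (intro R[rule_format]) simp
    then show "\<forall>\<^sub>F \<delta> in at_right 0. ereal (ln (real (box_count \<delta> F)) / (- ln \<delta>)) < y"
      using eventually_at_right_0_less[OF zero_less_one]
    proof eventually_elim
      case (elim \<delta>)
      then have "ln (real (box_count \<delta> F)) / (- ln \<delta>) \<le> r"
        using box_count_pos[OF F(1) _ F(2), of \<delta>] by (subst log_quotient_le_iff) auto
      then show ?case using r(2) by (metis ereal_less_eq(3) le_less_trans)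
    qed
  qed
qed

lemma le_lower_box_dim_iff:
  assumes F: "bounded F" "F \<noteq> {}"
  shows "ereal a \<le> lower_box_dim F \<longleftrightarrow>
    (\<forall>e>0. \<forall>\<^sub>F \<delta> in at_right 0. \<delta> powr - (a - e) \<le> real (box_count \<delta> F))"
proof
  assume L: "ereal a \<le> lower_box_dim F"
  show "\<forall>e>0. \<forall>\<^sub>F \<delta> in at_right 0. \<delta> powr - (a - e) \<le> real (box_count \<delta> F)"
  proof (intro allI impI)
    fix e :: real assume "0 < e"
    then have "ereal (a - e) < ereal a" by simp
    with L have "\<forall>\<^sub>F \<delta> in at_right 0. ereal (a - e) < ereal (ln (real (box_count \<delta> F)) / (- ln \<delta>))"
      unfolding lower_box_dim_def le_Liminf_iff by blast
    then show "\<forall>\<^sub>F \<delta> in at_right 0. \<delta> powr - (a - e) \<le> real (box_count \<delta> F)"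
      using eventually_at_right_0_less[OF zero_less_one]
    proof eventually_elim
      case (elim \<delta>)
      then have "a - e \<le> ln (real (box_count \<delta> F)) / (- ln \<delta>)" by simp
      then show ?case using elim box_count_pos[OF F(1) _ F(2), of \<delta>]
        by (subst (asm) le_log_quotient_iff) auto
    qed
  qed
next
  assume R: "\<forall>e>0. \<forall>\<^sub>F \<delta> in at_right 0. \<delta> powr - (a - e) \<le> real (box_count \<delta> F)"
  show "ereal a \<le> lower_box_dim F"
    unfolding lower_box_dim_def le_Liminf_iff
  proof (intro allI impI)
    fix y assume "y < ereal a"
    then obtain r where r: "y < ereal r" "ereal r < ereal a" using ereal_dense2 by blast
    then have "\<forall>\<^sub>F \<delta> in at_right 0. \<delta> powr - (a - (a - r)) \<le> real (box_count \<delta> F)"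
      using r(2) by (intro R[rule_format]) simp
    then show "\<forall>\<^sub>F \<delta> in at_right 0. y < ereal (ln (real (box_count \<delta> F)) / (- ln \<delta>))"
      using eventually_at_right_0_less[OF zero_less_one]
    proof eventually_elim
      case (elim \<delta>)
      then have "r \<le> ln (real (box_count \<delta> F)) / (- ln \<delta>)"
        using box_count_pos[OF F(1) _ F(2), of \<delta>] by (subst le_log_quotient_iff) auto
      then show ?case using r(1) by (metis ereal_less_eq(3) less_le_trans)
    qed
  qed
qed

text \<open>Both comparisons between box counts and oscillation sums enter. The term
  \<open>\<delta> powr - real CARD('d)\<close> is harmless because the dimension is at most
  \<open>\<alpha>\<close>. The constant \<open>A\<close> is left free so that the condition passes
  to sums and multiples.\<close>

lemma C_space_iff:
  fixes f :: "'d::finite unit_cube \<Rightarrow>\<^sub>C real"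
  assumes \<alpha>: "real CARD('d) \<le> \<alpha>"
  shows "f \<in> C_space \<alpha> \<longleftrightarrow>
    (\<forall>e>0. \<exists>A. \<forall>\<^sub>F \<delta> in at_right 0. osc_sum \<delta> f \<le> A * \<delta> powr (1 - \<alpha> - e))"
  unfolding C_space_def mem_Collect_eq upper_box_dim_le_iff[OF bounded_graph graph_nonempty]
proof (intro iffI allI impI)
  fix e :: real
  assume "\<forall>e>0. \<forall>\<^sub>F \<delta> in at_right 0. real (box_count \<delta> (graph f)) \<le> \<delta> powr - (\<alpha> + e)" and "0 < e"
  then have "\<forall>\<^sub>F \<delta> in at_right 0. real (box_count \<delta> (graph f)) \<le> \<delta> powr - (\<alpha> + e)" by blast
  then have "\<forall>\<^sub>F \<delta> in at_right 0. osc_sum \<delta> f \<le> 1 * \<delta> powr (1 - \<alpha> - e)"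
    using eventually_at_right_0_less[OF zero_less_one]
  proof eventually_elim
    case (elim \<delta>)
    have "osc_sum \<delta> f \<le> \<delta> * real (box_count \<delta> (graph f))"
      using elim by (intro osc_sum_le_box_count) simp
    also have "\<dots> \<le> \<delta> powr 1 * \<delta> powr - (\<alpha> + e)"
      using elim by (simp add: mult_left_mono)
    also have "\<dots> = 1 * \<delta> powr (1 - \<alpha> - e)"
      unfolding powr_add[symmetric] by (simp add: algebra_simps)
    finally show ?case .
  qed
  then show "\<exists>A. \<forall>\<^sub>F \<delta> in at_right 0. osc_sum \<delta> f \<le> A * \<delta> powr (1 - \<alpha> - e)" by blast
next
  fix e :: real
  assume "\<forall>e>0. \<exists>A. \<forall>\<^sub>F \<delta> in at_right 0. osc_sum \<delta> f \<le> A * \<delta> powr (1 - \<alpha> - e)" and e: "0 < e"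
  \<comment> \<open>Half of the slack is kept back: the spare factor
    \<open>\<delta> powr (e / 2)\<close> tends to 0 and absorbs the constant
    \<open>?K\<close>.\<close>
  then obtain A where A: "\<forall>\<^sub>F \<delta> in at_right 0. osc_sum \<delta> f \<le> A * \<delta> powr (1 - \<alpha> - e / 2)"
    using half_gt_zero by blast
  let ?K = "2 * 3 ^ (CARD('d) + 1) * (2 ^ CARD('d) + A) :: real"
  have "((\<lambda>\<delta>. ?K * \<delta> powr (e / 2)) \<longlongrightarrow> 0) (at_right 0)"
    using e by real_asymp
  then have "\<forall>\<^sub>F \<delta> in at_right 0. ?K * \<delta> powr (e / 2) < 1"
    by (rule order_tendstoD) simp
  then show "\<forall>\<^sub>F \<delta> in at_right 0. real (box_count \<delta> (graph f)) \<le> \<delta> powr - (\<alpha> + e)"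
    using A eventually_at_right_0_less[OF zero_less_one]
  proof eventually_elim
    case (elim \<delta>)
    have "osc_sum \<delta> f / \<delta> \<le> A * \<delta> powr (1 - \<alpha> - e / 2) / \<delta> powr 1"
      using elim by (simp add: divide_right_mono)
    also have "\<dots> = A * \<delta> powr - (\<alpha> + e / 2)"
      unfolding times_divide_eq_right[symmetric] powr_diff[symmetric] by (simp add: algebra_simps)
    finally have osc: "osc_sum \<delta> f / \<delta> \<le> A * \<delta> powr - (\<alpha> + e / 2)" .
    have "\<delta> powr - real CARD('d) \<le> \<delta> powr - (\<alpha> + e / 2)"
      using elim \<alpha> e by (intro powr_mono') auto
    then have "2 ^ CARD('d) * \<delta> powr - real CARD('d) + osc_sum \<delta> f / \<delta>
        \<le> 2 ^ CARD('d) * \<delta> powr - (\<alpha> + e / 2) + A * \<delta> powr - (\<alpha> + e / 2)"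
      using osc by (intro add_mono mult_left_mono) auto
    then have "real (box_count \<delta> (graph f)) \<le> 2 * 3 ^ (CARD('d) + 1) *
        (2 ^ CARD('d) * \<delta> powr - (\<alpha> + e / 2) + A * \<delta> powr - (\<alpha> + e / 2))"
      using box_count_le_osc_sum[of \<delta> f] elim
      by (intro order.trans[OF box_count_le_osc_sum] mult_left_mono) auto
    also have "\<dots> = ?K * \<delta> powr - (\<alpha> + e / 2)" by (simp add: algebra_simps)
    also have "\<dots> = (?K * \<delta> powr (e / 2)) * \<delta> powr - (\<alpha> + e)"
    proof -
      have "- (\<alpha> + e / 2) = e / 2 + - (\<alpha> + e)" by (simp add: field_simps)
      then show ?thesis by (simp only: powr_add mult.assoc)
    qed
    also have "\<dots> \<le> 1 * \<delta> powr - (\<alpha> + e)"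
      using elim by (intro mult_right_mono) auto
    finally show ?case by simp
  qed
qed

text \<open>The growth criterion with free constants is stable under the operations because
  \<open>osc_sum\<close> is a seminorm.\<close>

lemma subspace_C_space:
  assumes \<alpha>: "real CARD('d::finite) \<le> \<alpha>"
  shows "subspace (C_space \<alpha> :: ('d unit_cube \<Rightarrow>\<^sub>C real) set)"
proof (rule subspaceI)
  have "\<forall>\<^sub>F \<delta> in at_right 0. osc_sum \<delta> (0 :: 'd unit_cube \<Rightarrow>\<^sub>C real) \<le> 0 * \<delta> powr r" for r :: real
    using eventually_at_right_0_less[OF zero_less_one]
  proof eventually_elim
    case (elim \<delta>)
    then show ?case using osc_sum_scaleR[of \<delta> 0 "0 :: 'd unit_cube \<Rightarrow>\<^sub>C real"] by simp
  qed
  then show "0 \<in> (C_space \<alpha> :: ('d unit_cube \<Rightarrow>\<^sub>C real) set)"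
    unfolding C_space_iff[OF \<alpha>] by blast
next
  fix f g :: "'d unit_cube \<Rightarrow>\<^sub>C real" assume fg: "f \<in> C_space \<alpha>" "g \<in> C_space \<alpha>"
  show "f + g \<in> C_space \<alpha>"
    unfolding C_space_iff[OF \<alpha>]
  proof (intro allI impI)
    fix e :: real assume e: "0 < e"
    obtain A where "\<forall>\<^sub>F \<delta> in at_right 0. osc_sum \<delta> f \<le> A * \<delta> powr (1 - \<alpha> - e)"
      using fg(1) e unfolding C_space_iff[OF \<alpha>] by blast
    moreover obtain B where "\<forall>\<^sub>F \<delta> in at_right 0. osc_sum \<delta> g \<le> B * \<delta> powr (1 - \<alpha> - e)"
      using fg(2) e unfolding C_space_iff[OF \<alpha>] by blast
    ultimately have "\<forall>\<^sub>F \<delta> in at_right 0. osc_sum \<delta> (f + g) \<le> (A + B) * \<delta> powr (1 - \<alpha> - e)"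
      using eventually_at_right_0_less[OF zero_less_one]
    proof eventually_elim
      case (elim \<delta>)
      then show ?case using osc_sum_add[of \<delta> f g] by (simp add: distrib_right)
    qed
    then show "\<exists>A. \<forall>\<^sub>F \<delta> in at_right 0. osc_sum \<delta> (f + g) \<le> A * \<delta> powr (1 - \<alpha> - e)" by blast
  qed
next
  fix f :: "'d unit_cube \<Rightarrow>\<^sub>C real" and c :: real assume f: "f \<in> C_space \<alpha>"
  show "c *\<^sub>R f \<in> C_space \<alpha>"
    unfolding C_space_iff[OF \<alpha>]
  proof (intro allI impI)
    fix e :: real assume e: "0 < e"
    obtain A where "\<forall>\<^sub>F \<delta> in at_right 0. osc_sum \<delta> f \<le> A * \<delta> powr (1 - \<alpha> - e)"
      using f e unfolding C_space_iff[OF \<alpha>] by blast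
    then have "\<forall>\<^sub>F \<delta> in at_right 0. osc_sum \<delta> (c *\<^sub>R f) \<le> (\<bar>c\<bar> * A) * \<delta> powr (1 - \<alpha> - e)"
      using eventually_at_right_0_less[OF zero_less_one]
    proof eventually_elim
      case (elim \<delta>)
      then show ?case by (simp add: osc_sum_scaleR mult.assoc mult_left_mono)
    qed
    then show "\<exists>A. \<forall>\<^sub>F \<delta> in at_right 0. osc_sum \<delta> (c *\<^sub>R f) \<le> A * \<delta> powr (1 - \<alpha> - e)" by blast
  qed
qed

lemma in_C_spaceI:
  fixes f :: "'d::finite unit_cube \<Rightarrow>\<^sub>C real"
  assumes \<alpha>: "real CARD('d) \<le> \<alpha>"
    and le: "\<And>\<delta>. 0 < \<delta> \<Longrightarrow> \<delta> \<le> 1 \<Longrightarrow> osc_sum \<delta> f \<le> A * \<delta> powr (1 - \<alpha>)"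
  shows "f \<in> C_space \<alpha>"
  unfolding C_space_iff[OF \<alpha>]
proof (intro allI impI exI)
  fix e :: real assume e: "0 < e"
  show "\<forall>\<^sub>F \<delta> in at_right 0. osc_sum \<delta> f \<le> A * \<delta> powr (1 - \<alpha> - e)"
    using eventually_at_right_0_less[OF zero_less_one]
  proof eventually_elim
    case (elim \<delta>)
    \<comment> \<open>Scale 1 shows the sign of \<open>A\<close>, which decides the direction of the
      estimate when the power is enlarged.\<close>
    have "0 \<le> A" using le[of 1] osc_sum_nonneg[of 1 f] by simp
    have "osc_sum \<delta> f \<le> A * \<delta> powr (1 - \<alpha>)" using le elim by simp
    also have "\<dots> \<le> A * \<delta> powr (1 - \<alpha> - e)"
      using elim e \<open>0 \<le> A\<close> by (intro mult_left_mono powr_mono') auto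
    finally show ?case .
  qed
qed

text \<open>Every oscillation is at most \<open>2 * norm f\<close>, and the number of cubes is of
  order \<open>\<delta> powr - real CARD('d)\<close>. The full space is thus the case
  \<open>\<alpha> = d + 1\<close> of the scale of spaces.\<close>

lemma C_space_top: "C_space (real CARD('d) + 1) = (UNIV :: ('d::finite unit_cube \<Rightarrow>\<^sub>C real) set)"
proof -
  have "f \<in> C_space (real CARD('d) + 1)" for f :: "'d unit_cube \<Rightarrow>\<^sub>C real"
  proof (rule in_C_spaceI)
    fix \<delta> :: real assume \<delta>: "0 < \<delta>" "\<delta> \<le> 1"
    have "osc_sum \<delta> f \<le> 2 ^ CARD('d) * \<delta> powr - real CARD('d) * (2 * norm f)"
    proof (rule osc_sum_le[OF \<delta>])
      fix x y
      show "\<bar>f x - f y\<bar> \<le> 2 * norm f" using norm_bounded[of f x] norm_bounded[of f y] by simp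
    qed simp
    then show "osc_sum \<delta> f \<le> (2 ^ CARD('d) * (2 * norm f)) * \<delta> powr (1 - (real CARD('d) + 1))"
      by (simp add: mult_ac)
  qed simp
  then show ?thesis by blast
qed

text \<open>The lower dimension never exceeds the upper one, so inside
  \<open>C_space \<alpha>\<close> the lower bound forces both to equal
  \<open>\<alpha>\<close>.\<close>

lemma D_space_eq: "D_space \<alpha> = {f \<in> C_space \<alpha>. ereal \<alpha> \<le> lower_box_dim (graph f)}"
proof -
  have "lower_box_dim (graph f) \<le> upper_box_dim (graph f)" for f :: "'a unit_cube \<Rightarrow>\<^sub>C real"
    unfolding lower_box_dim_def upper_box_dim_def by (intro Liminf_le_Limsup) simp
  then show ?thesis
    unfolding D_space_def C_space_def by (auto intro: antisym order.trans)
qed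

text \<open>A scale \<open>\<delta>\<close> is compared with the next larger dyadic scale, at the
  cost of a constant factor. The fourth power is polynomial in \<open>log 2 \<delta>\<close> and
  therefore smaller than any power of \<open>1 / \<delta>\<close>.\<close>

lemma le_lower_box_dim_of_dyadic:
  fixes F :: "'a::euclidean_space set"
  assumes F: "bounded F" "F \<noteq> {}" and a: "0 \<le> a" and c: "0 < c"
    and dyadic: "\<forall>\<^sub>F k in sequentially.
      c * 2 powr (real k * a) / real (Suc k) ^ 4 \<le> real (box_count (1 / 2 ^ k) F)"
  shows "ereal a \<le> lower_box_dim F"
  unfolding le_lower_box_dim_iff[OF F]
proof (intro allI impI)
  fix e :: real assume e: "0 < e"
  \<comment> \<open>\<open>3 ^ DIM('a)\<close> pays for the change of scale, \<open>2 powr a\<close>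
    for rounding the exponent \<open>L\<close> down to \<open>k\<close>.\<close>
  define C where "C = c / (3 ^ DIM('a) * 2 powr a)"
  have C: "0 < C" using c by (simp add: C_def)
  obtain k0 where k0: "\<And>k. k0 \<le> k \<Longrightarrow>
      c * 2 powr (real k * a) / real (Suc k) ^ 4 \<le> real (box_count (1 / 2 ^ k) F)"
    using dyadic unfolding eventually_sequentially by blast
  have "((\<lambda>\<delta>. (1 - log 2 \<delta>) ^ 4 * \<delta> powr e) \<longlongrightarrow> 0) (at_right 0)"
    using e by real_asymp
  then have "\<forall>\<^sub>F \<delta> in at_right 0. (1 - log 2 \<delta>) ^ 4 * \<delta> powr e < C"
    by (rule order_tendstoD) (fact C)
  then show "\<forall>\<^sub>F \<delta> in at_right 0. \<delta> powr - (a - e) \<le> real (box_count \<delta> F)"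
    using eventually_at_right_0_less[OF zero_less_one] 
      eventually_at_right_0_less[of "2 powr - (real k0 + 1)", simplified]
  proof eventually_elim
    case (elim \<delta>)
    then have \<delta>: "0 < \<delta>" "\<delta> < 1" by auto
    define L where "L = - log 2 \<delta>"
    have \<delta>L: "\<delta> = 2 powr - L" using \<delta> by (simp add: L_def)
    \<comment> \<open>The restriction on \<open>\<delta>\<close> ensures that the rounded exponent
      is still at least \<open>k0\<close>.\<close>
    have "log 2 \<delta> < - (real k0 + 1)" using elim \<delta> by (simp add: log_less_iff)
    then have L: "real k0 + 1 < L" by (simp add: L_def)
    define k where "k = nat \<lfloor>L\<rfloor>"
    have k: "real k \<le> L" "L < real k + 1" "k0 \<le> k" using L unfolding k_def by linarith+
    have le: "\<delta> \<le> 1 / 2 ^ k"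
    proof -
      have "2 powr - L \<le> 2 powr - real k" using k by (intro powr_mono) auto
      then show ?thesis unfolding \<delta>L by (simp add: powr_minus powr_realpow divide_inverse)
    qed
    have "\<delta> powr - (a - e) = (\<delta> powr e) * 2 powr (L * a)"
      unfolding \<delta>L by (simp add: powr_powr algebra_simps flip: powr_add)
    also have "\<dots> \<le> (C / (L + 1) ^ 4) * 2 powr (L * a)"
      using elim L by (intro mult_right_mono) (simp_all add: L_def pos_le_divide_eq mult.commute)
    also have "\<dots> \<le> (C / real (Suc k) ^ 4) * 2 powr ((real k + 1) * a)"
      using k L C a by (intro mult_mono divide_left_mono power_mono powr_mono mult_right_mono) (auto intro: mult_pos_pos)
    also have "\<dots> = (c * 2 powr (real k * a) / real (Suc k) ^ 4) / 3 ^ DIM('a)"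
      by (simp add: C_def distrib_right powr_add)
    also have "\<dots> \<le> real (box_count (1 / 2 ^ k) F) / 3 ^ DIM('a)"
      by (intro divide_right_mono k0 k) simp
    also have "\<dots> \<le> real (box_count \<delta> F)"
      using of_nat_mono[OF box_count_mono_scale[OF F(1) \<delta>(1) le], where 'a = real]
      by (simp add: pos_divide_le_eq mult.commute)
    finally show ?case .
  qed
qed

section \<open>A Takagi function as probe\<close>

definition sawtooth :: "real \<Rightarrow> real"
  where "sawtooth t = \<bar>t - of_int (round t)\<bar>"

lemma sawtooth_nonneg: "0 \<le> sawtooth t"
  by (simp add: sawtooth_def)

lemma sawtooth_le_half: "sawtooth t \<le> 1 / 2"
  using of_int_round_abs_le[of t] by (simp add: sawtooth_def abs_minus_commute)

lemma sawtooth_le: "sawtooth t \<le> \<bar>t - of_int m\<bar>"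
  unfolding sawtooth_def by (rule round_diff_minimal)

lemma sawtooth_of_int: "sawtooth (of_int m) = 0"
  by (simp add: sawtooth_def)

lemma sawtooth_lipschitz: "\<bar>sawtooth u - sawtooth v\<bar> \<le> \<bar>u - v\<bar>"
proof -
  have "sawtooth u \<le> \<bar>u - v\<bar> + sawtooth v" for u v
    using sawtooth_le[of u "round v"] by (simp add: sawtooth_def)
  from this[of u v] this[of v u] show ?thesis by (simp add: abs_minus_commute abs_le_iff)
qed

text \<open>On the first half of a unit interval its left end is a nearest integer, since every
  integer further right is at distance at least \<open>1 / 2\<close>.\<close>

lemma sawtooth_eq_diff:
  assumes "of_int m \<le> t" "t \<le> of_int m + 1 / 2"
  shows "sawtooth t = t - of_int m"
proof (rule antisym)
  show "sawtooth t \<le> t - of_int m" using sawtooth_le[of t m] assms by simp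
  have "t - of_int m \<le> \<bar>t - of_int n\<bar>" for n
  proof (cases "n \<le> m")
    case True
    then have "real_of_int n \<le> of_int m" by simp
    then show ?thesis by linarith
  next
    case False
    then have "real_of_int m + 1 \<le> of_int n" by linarith
    then show ?thesis using assms by linarith
  qed
  then show "t - of_int m \<le> sawtooth t" by (simp add: sawtooth_def)
qed

lemma sawtooth_minus: "sawtooth (- t) = sawtooth t"
proof -
  have "sawtooth (- t) \<le> sawtooth t" for t
    using sawtooth_le[of "- t" "- round t"] by (simp add: sawtooth_def abs_minus_commute)
  from this[of t] this[of "- t"] show ?thesis by simp
qed

text \<open>Between consecutive half integers the sawtooth is affine: rising for even
  \<open>p\<close>, falling for odd \<open>p\<close>. The falling case is the rising one reflected
  at 0.\<close>

lemma sawtooth_affine: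
  fixes p :: int
  assumes "of_int p / 2 \<le> u" "u \<le> v" "v \<le> (of_int p + 1) / 2"
  shows "sawtooth ((u + v) / 2) = (sawtooth u + sawtooth v) / 2"
proof (cases "even p")
  case True
  then obtain m where "p = 2 * m" by (auto elim: evenE)
  then have *: "sawtooth t = t - of_int m" if "u \<le> t" "t \<le> v" for t
    using assms that by (intro sawtooth_eq_diff) auto
  show ?thesis using assms by (simp add: * field_simps)
next
  case False
  then obtain m where p: "p = 2 * m + 1" by (auto elim: oddE)
  have *: "sawtooth t = of_int (m + 1) - t" if "u \<le> t" "t \<le> v" for t
  proof -
    have "sawtooth (- t) = - t - of_int (- (m + 1))"
      using assms that p by (intro sawtooth_eq_diff) auto
    then show ?thesis by (simp add: sawtooth_minus)
  qed
  show ?thesis using assms by (simp add: * field_simps)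
qed

text \<open>With \<open>a k = 1 / 2 ^ k\<close> this is the classical Takagi or blancmange
  function.\<close>

definition takagi :: "(nat \<Rightarrow> real) \<Rightarrow> real \<Rightarrow> real"
  where "takagi a t = (\<Sum>k. a k * sawtooth (2 ^ k * t))"

lemma summable_takagi:
  assumes "summable a" "\<And>k. 0 \<le> a k"
  shows "summable (\<lambda>k. a k * sawtooth (2 ^ k * t))"
proof (rule summable_comparison_test'[OF assms(1), of 0])
  fix k
  have "sawtooth (2 ^ k * t) \<le> 1" using sawtooth_le_half[of "2 ^ k * t"] by simp
  then show "norm (a k * sawtooth (2 ^ k * t)) \<le> a k"
    using assms(2)[of k] sawtooth_nonneg[of "2 ^ k * t"] by (simp add: abs_mult mult_left_le)
qed

lemma continuous_on_takagi:
  assumes "summable a" "\<And>k. 0 \<le> a k"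
  shows "continuous_on UNIV (takagi a)"
proof -
  have saw: "continuous_on UNIV sawtooth"
    unfolding continuous_on_iff dist_real_def
    using sawtooth_lipschitz le_less_trans by blast
  have "uniform_limit UNIV (\<lambda>n t. \<Sum>k<n. a k * sawtooth (2 ^ k * t)) (takagi a) sequentially"
    unfolding takagi_def
  proof (rule Weierstrass_m_test[OF _ assms(1)])
    fix k t
    have "sawtooth (2 ^ k * t) \<le> 1" using sawtooth_le_half[of "2 ^ k * t"] by simp
    then show "norm (a k * sawtooth (2 ^ k * t)) \<le> a k"
      using assms(2)[of k] sawtooth_nonneg[of "2 ^ k * t"] by (simp add: abs_mult mult_left_le)
  qed
  then show ?thesis
    by (rule uniform_limit_theorem[rotated])
      (auto intro!: always_eventually continuous_intros continuous_on_compose2[OF saw])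
qed

text \<open>At the midpoint of a dyadic interval of length \<open>1 / 2 ^ k\<close> only the \<open>k\<close>-th term of the series
  contributes to the second difference: earlier terms are affine on the interval and later terms
  vanish at all three points.\<close>

lemma takagi_second_difference:
  fixes j :: int
  assumes "summable a" "\<And>k. 0 \<le> a k"
  shows "takagi a ((of_int j + 1 / 2) / 2 ^ k) -
      (takagi a (of_int j / 2 ^ k) + takagi a ((of_int j + 1) / 2 ^ k)) / 2 = a k / 2"
proof -
  let ?l = "of_int j / 2 ^ k :: real" and ?r = "(of_int j + 1) / 2 ^ k :: real"
  let ?m = "(of_int j + 1 / 2) / 2 ^ k :: real"
  let ?s = "\<lambda>t i. a i * sawtooth (2 ^ i * t)"
  let ?D = "\<lambda>i. ?s ?m i - (?s ?l i + ?s ?r i) / 2"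
  have "?D sums (takagi a ?m - (takagi a ?l + takagi a ?r) / 2)"
    unfolding takagi_def using summable_takagi[OF assms]
    by (intro sums_diff sums_divide sums_add summable_sums)
  moreover have "?D i = (if i = k then a k / 2 else 0)" for i
  proof (cases i k rule: linorder_cases)
    case less
    \<comment> \<open>A half period of the \<open>i\<close>-th sawtooth consists of \<open>M\<close>
      dyadic intervals of length \<open>1 / 2 ^ k\<close>, and \<open>p\<close> numbers the half
      period that contains the interval with index \<open>j\<close>.\<close>
    define M :: int where "M = 2 ^ (k - i - 1)"
    have M: "0 < M" "(2 :: real) ^ k = 2 ^ i * (2 * of_int M)"
    proof -
      have "k = i + (Suc (k - i - 1))" using less by simp
      then have "(2 :: real) ^ k = 2 ^ i * 2 ^ Suc (k - i - 1)" by (metis power_add)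
      then show "(2 :: real) ^ k = 2 ^ i * (2 * of_int M)" by (simp add: M_def)
    qed (simp add: M_def)
    define p where "p = j div M"
    have p: "p * M \<le> j" "j + 1 \<le> (p + 1) * M"
    proof -
      have "j = p * M + j mod M" by (simp add: p_def)
      moreover have "0 \<le> j mod M" "j mod M < M" using M(1) by auto
      ultimately show "p * M \<le> j" "j + 1 \<le> (p + 1) * M" by (auto simp: algebra_simps)
    qed
    have p': "of_int p * of_int M \<le> (of_int j :: real)" "of_int j + 1 \<le> (of_int p + 1) * (of_int M :: real)"
      using p by (metis of_int_le_iff of_int_mult, metis of_int_le_iff of_int_mult of_int_add of_int_1)
    have l: "2 ^ i * ?l = of_int j / (2 * of_int M)" and r: "2 ^ i * ?r = (of_int j + 1) / (2 * of_int M)"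
      and m: "2 ^ i * ?m = (2 ^ i * ?l + 2 ^ i * ?r) / 2"
      using M by (simp_all add: field_simps)
    have "sawtooth ((2 ^ i * ?l + 2 ^ i * ?r) / 2) = (sawtooth (2 ^ i * ?l) + sawtooth (2 ^ i * ?r)) / 2"
    proof (rule sawtooth_affine)
      show "of_int p / 2 \<le> 2 ^ i * ?l" unfolding l using p'(1) M(1) by (simp add: field_simps)
      show "2 ^ i * ?l \<le> 2 ^ i * ?r" by (simp add: divide_right_mono)
      show "2 ^ i * ?r \<le> (of_int p + 1) / 2" unfolding r using p'(2) M(1) by (simp add: field_simps)
    qed
    then show ?thesis using less unfolding m by (simp add: algebra_simps)
  next
    case equal
    have "sawtooth (of_int j + 1 / 2) = 1 / 2"
      using sawtooth_eq_diff[of j "of_int j + 1 / 2"] by simp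
    moreover have "sawtooth (of_int j + 1) = 0" using sawtooth_of_int[of "j + 1"] by simp
    ultimately show ?thesis using equal by (simp add: sawtooth_of_int)
  next
    case greater
    \<comment> \<open>The factor 2 split off here cancels the \<open>1 / 2\<close> in the midpoint,
      so the midpoint too is mapped to an integer.\<close>
    have e: "(2 :: real) ^ i = 2 * 2 ^ (i - k - 1) * 2 ^ k"
    proof -
      have "i = Suc (i - k - 1) + k" using greater by simp
      then show ?thesis by (metis power_add power_Suc)
    qed
    have "2 ^ i * ?l = of_int (2 * 2 ^ (i - k - 1) * j)"
      "2 ^ i * ?r = of_int (2 * 2 ^ (i - k - 1) * (j + 1))"
      "2 ^ i * ?m = of_int (2 ^ (i - k - 1) * (2 * j + 1))"
      unfolding e by (simp_all add: field_simps)
    then have "sawtooth (2 ^ i * ?l) = 0" "sawtooth (2 ^ i * ?r) = 0" "sawtooth (2 ^ i * ?m) = 0"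
      by (simp_all only: sawtooth_of_int)
    then show ?thesis using greater by simp
  qed
  ultimately have "(\<lambda>i. if i = k then a k / 2 else 0) sums
      (takagi a ?m - (takagi a ?l + takagi a ?r) / 2)" by simp
  moreover have "(\<lambda>i. if i = k then a k / 2 else 0) sums (a k / 2)"
    using sums_single[of k "\<lambda>_. a k / 2"] by simp
  ultimately show ?thesis by (rule sums_unique2)
qed

text \<open>The factor \<open>2 powr - (k * s)\<close> makes the Takagi series \<open>s\<close>-Hoelder with oscillation of that order
  on dyadic intervals of length \<open>1 / 2 ^ k\<close>. The square in the denominator keeps the series summable
  for \<open>s = 0\<close> as well and does not affect exponents.\<close>

definition probe_coeff :: "real \<Rightarrow> nat \<Rightarrow> real"
  where "probe_coeff s k = 2 powr - (real k * s) / real (Suc k) ^ 2"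

section \<open>Hoelder continuity of the probe series\<close>

lemma summable_inverse_Suc_square: "summable (\<lambda>k. 1 / real (Suc k) ^ 2)"
  using inverse_power_summable[of 2, where 'a = real] 
  by (subst summable_Suc_iff[of "\<lambda>n. 1 / real n ^ 2"]) (simp add: inverse_eq_divide)

lemma probe_coeff_nonneg: "0 \<le> probe_coeff s k"
  by (simp add: probe_coeff_def)

lemma summable_probe_coeff:
  assumes "0 \<le> s"
  shows "summable (probe_coeff s)"
proof (rule summable_comparison_test'[OF summable_inverse_Suc_square, of 0])
  fix k
  have "2 powr - (real k * s) \<le> 2 powr 0" using assms by (intro powr_mono) auto
  then show "norm (probe_coeff s k) \<le> 1 / real (Suc k) ^ 2"
    by (simp add: probe_coeff_def divide_right_mono del: of_nat_Suc)
qed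

text \<open>This interpolates between the two bounds 1 and \<open>y\<close>; it is used with
  \<open>y = 2 ^ k * \<delta>\<close>, the Lipschitz bound for the \<open>k\<close>-th
  sawtooth.\<close>

lemma min_one_le_powr:
  fixes y s :: real
  assumes "0 < y" "0 \<le> s" "s \<le> 1"
  shows "min 1 y \<le> y powr s"
proof (cases "1 \<le> y")
  case True
  then show ?thesis using ge_one_powr_ge_zero[of y s] assms by auto
next
  case False
  then show ?thesis using powr_mono'[of s 1 y] assms by auto
qed

text \<open>The \<open>k\<close>-th sawtooth differs by at most 1 and by at most
  \<open>2 ^ k * \<delta>\<close>, hence by at most \<open>(2 ^ k * \<delta>) powr s\<close>. The
  coefficient cancels the growing factor \<open>2 powr (real k * s)\<close> and leaves a convergent
  series times \<open>\<delta> powr s\<close>.\<close>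

lemma takagi_hoelder:
  assumes s: "0 \<le> s" "s \<le> 1" and \<delta>: "0 < \<delta>" and uv: "\<bar>u - v\<bar> \<le> \<delta>"
  shows "\<bar>takagi (probe_coeff s) u - takagi (probe_coeff s) v\<bar> \<le> (\<Sum>k. 1 / real (Suc k) ^ 2) * \<delta> powr s"
proof -
  let ?a = "probe_coeff s"
  let ?t = "\<lambda>k. ?a k * sawtooth (2 ^ k * u) - ?a k * sawtooth (2 ^ k * v)"
  let ?b = "\<lambda>k. 1 / real (Suc k) ^ 2 * \<delta> powr s"
  have t: "?t sums (takagi ?a u - takagi ?a v)"
    unfolding takagi_def using summable_takagi[OF summable_probe_coeff[OF s(1)] probe_coeff_nonneg]
    by (intro sums_diff summable_sums)
  have b: "summable ?b" by (rule summable_mult2[OF summable_inverse_Suc_square])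
  have le: "norm (?t k) \<le> ?b k" for k
  proof -
    have "\<bar>sawtooth (2 ^ k * u) - sawtooth (2 ^ k * v)\<bar> \<le> 1"
      using sawtooth_le_half[of "2 ^ k * u"] sawtooth_le_half[of "2 ^ k * v"]
        sawtooth_nonneg[of "2 ^ k * u"] sawtooth_nonneg[of "2 ^ k * v"] by linarith
    moreover have "\<bar>sawtooth (2 ^ k * u) - sawtooth (2 ^ k * v)\<bar> \<le> 2 ^ k * \<delta>"
    proof -
      have "\<bar>2 ^ k * u - 2 ^ k * v\<bar> = 2 ^ k * \<bar>u - v\<bar>"
        unfolding right_diff_distrib[symmetric] abs_mult by simp
      also have "\<dots> \<le> 2 ^ k * \<delta>" using uv by simp
      finally show ?thesis using sawtooth_lipschitz[of "2 ^ k * u" "2 ^ k * v"] by linarith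
    qed
    ultimately have "\<bar>sawtooth (2 ^ k * u) - sawtooth (2 ^ k * v)\<bar> \<le> (2 ^ k * \<delta>) powr s"
      using min_one_le_powr[of "2 ^ k * \<delta>" s] s \<delta> by simp
    then have "?a k * \<bar>sawtooth (2 ^ k * u) - sawtooth (2 ^ k * v)\<bar> \<le> ?a k * (2 ^ k * \<delta>) powr s"
      by (rule mult_left_mono[OF _ probe_coeff_nonneg])
    also have "(2 ^ k * \<delta>) powr s = 2 powr (real k * s) * \<delta> powr s"
    proof -
      have "(2 :: real) ^ k = 2 powr real k" by (simp add: powr_realpow)
      then show ?thesis using \<delta> by (simp only: powr_mult powr_powr)
    qed
    also have "?a k * (2 powr (real k * s) * \<delta> powr s) = ?b k"
      by (simp add: probe_coeff_def powr_minus)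
    finally show ?thesis
      unfolding right_diff_distrib[symmetric] real_norm_def abs_mult abs_of_nonneg[OF probe_coeff_nonneg] .
  qed
  have "norm (\<Sum>k. ?t k) \<le> (\<Sum>k. ?b k)" by (rule norm_suminf_le[OF le b])
  also have "(\<Sum>k. ?b k) = (\<Sum>k. 1 / real (Suc k) ^ 2) * \<delta> powr s"
    by (rule suminf_mult2[symmetric, OF summable_inverse_Suc_square])
  finally show ?thesis using sums_unique[OF t] by simp
qed

text \<open>\<open>undefined\<close> is an arbitrary but fixed coordinate.\<close>

definition probe_fun :: "real \<Rightarrow> ('d::finite unit_cube \<Rightarrow>\<^sub>C real)"
  where "probe_fun s = Bcontfun (\<lambda>x. takagi (probe_coeff s) (pt x $ undefined))"

lemma apply_probe_fun:
  fixes x :: "'d::finite unit_cube"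
  assumes "0 \<le> s"
  shows "probe_fun s x = takagi (probe_coeff s) (pt x $ undefined)"
proof -
  have "continuous_on UNIV (\<lambda>x :: 'd unit_cube. takagi (probe_coeff s) (pt x $ undefined))"
    by (rule continuous_on_compose2[OF continuous_on_takagi[OF summable_probe_coeff[OF assms] probe_coeff_nonneg]])
      (auto intro!: continuous_intros continuous_on_pt)
  then show ?thesis
    unfolding probe_fun_def by (simp add: Bcontfun_inverse continuous_imp_bcontfun)
qed

text \<open>Two points of one cube differ by at most \<open>\<delta>\<close> in the chosen
  coordinate, so the Hoelder bound applies on every cube. For \<open>s = d + 1 - \<alpha>\<close>
  the exponent is \<open>1 - \<alpha>\<close>, which puts the probe into
  \<open>C_space \<alpha>\<close>.\<close>

lemma osc_sum_probe_fun_le: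
  assumes s: "0 \<le> s" "s \<le> 1" and \<delta>: "0 < \<delta>" "\<delta> \<le> 1"
  shows "osc_sum \<delta> (probe_fun s :: 'd::finite unit_cube \<Rightarrow>\<^sub>C real)
    \<le> 2 ^ CARD('d) * (\<Sum>k. 1 / real (Suc k) ^ 2) * \<delta> powr (s - real CARD('d))"
proof -
  let ?C = "\<Sum>k. 1 / real (Suc k) ^ 2"
  have C: "0 \<le> ?C" by (intro suminf_nonneg summable_inverse_Suc_square) simp
  have "osc_sum \<delta> (probe_fun s :: 'd unit_cube \<Rightarrow>\<^sub>C real) \<le> 2 ^ CARD('d) * \<delta> powr - real CARD('d) * (?C * \<delta> powr s)"
  proof (rule osc_sum_le[OF \<delta>])
    fix S :: "(real ^ 'd) set" and x y :: "'d unit_cube"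
    assume S: "S \<in> unit_mesh \<delta>" and xy: "pt x \<in> S" "pt y \<in> S"
    obtain n where n: "S = mesh_cube \<delta> n" using S by (auto simp: unit_mesh_def)
    let ?b = "axis undefined 1 :: real ^ 'd"
    have b: "?b \<in> Basis" by simp
    have "of_int (n ?b) * \<delta> \<le> pt z $ undefined \<and> pt z $ undefined \<le> (of_int (n ?b) + 1) * \<delta>"
      if "pt z \<in> S" for z
    proof -
      have "of_int (n ?b) * \<delta> \<le> pt z \<bullet> ?b \<and> pt z \<bullet> ?b \<le> (of_int (n ?b) + 1) * \<delta>"
        using that b unfolding n mesh_cube_def by blast
      then show ?thesis by (simp add: inner_axis)
    qed
    from this[OF xy(1)] this[OF xy(2)] have "\<bar>pt x $ undefined - pt y $ undefined\<bar> \<le> \<delta>"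
      by (simp add: distrib_right abs_le_iff)
    then show "\<bar>probe_fun s x - probe_fun s y\<bar> \<le> ?C * \<delta> powr s"
      unfolding apply_probe_fun[OF s(1)] by (rule takagi_hoelder[OF s \<delta>(1)])
  qed (use C in simp)
  also have "\<dots> = 2 ^ CARD('d) * ?C * \<delta> powr (s - real CARD('d))"
    by (simp add: powr_diff powr_minus divide_inverse)
  finally show ?thesis .
qed

text \<open>The chosen coordinate can be placed at both ends and at the midpoint of a dyadic
  interval without leaving \<open>S\<close>. The second difference there is the mean of two
  differences, each at most the oscillation.\<close>

lemma probe_fun_oscillation_ge:
  fixes S :: "(real ^ 'd::finite) set"
  assumes s: "0 \<le> s" and S: "S \<in> unit_mesh (1 / 2 ^ k)"
  shows "probe_coeff s k / 2 \<le> oscillation (probe_fun s) S"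
proof -
  let ?\<delta> = "1 / 2 ^ k :: real" and ?b = "axis undefined 1 :: real ^ 'd"
  have b: "?b \<in> Basis" by simp
  obtain n where n: "\<And>b. b \<in> Basis \<Longrightarrow> 0 \<le> n b \<and> n b \<le> \<lceil>1 / ?\<delta>\<rceil> - 1" "S = mesh_cube ?\<delta> n"
    using S unfolding unit_mesh_def by blast
  let ?c = "\<Sum>b\<in>Basis. (of_int (n b) * ?\<delta>) *\<^sub>R b :: real ^ 'd"
  have point: "\<exists>x :: 'd unit_cube. pt x \<in> S \<and> pt x $ undefined = (of_int (n ?b) + t) / 2 ^ k"
    if t: "0 \<le> t" "t \<le> 1" for t
  proof -
    let ?p = "?c + (t * ?\<delta>) *\<^sub>R ?b"
    have p: "of_int (n b) * ?\<delta> \<le> ?p \<bullet> b \<and> ?p \<bullet> b \<le> (of_int (n b) + 1) * ?\<delta>" if "b \<in> Basis" for b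
    proof -
      have "?p \<bullet> b = of_int (n b) * ?\<delta> + t * ?\<delta> * (?b \<bullet> b)"
        using that by (simp only: inner_add_left inner_sum_left_Basis inner_scaleR_left)
      moreover have "?b \<bullet> b = 0 \<or> ?b \<bullet> b = 1"
        using that b by (simp add: inner_Basis)
      ultimately show ?thesis using t by (auto simp: distrib_right add_divide_distrib divide_right_mono)
    qed
    have "0 \<le> ?p \<bullet> b \<and> ?p \<bullet> b \<le> 1" if b: "b \<in> Basis" for b
    proof -
      \<comment> \<open>At dyadic scales \<open>1 / ?\<delta>\<close> is an integer, so no cube
        sticks out of the unit cube and the whole edge is available.\<close>
      have "\<lceil>1 / ?\<delta>\<rceil> = 2 ^ k"
        using ceiling_of_int[of "2 ^ k", where 'a = real] by simp
      then have n': "0 \<le> n b" "n b + 1 \<le> 2 ^ k" using n(1)[OF b] by auto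
      have "real_of_int (n b) + 1 \<le> 2 ^ k"
        using of_int_le_iff[of "n b + 1" "2 ^ k", where 'a = real] n'(2) by simp
      then have "(of_int (n b) + 1) * ?\<delta> \<le> 1" by simp
      moreover have "0 \<le> of_int (n b) * ?\<delta>" using n'(1) by simp
      ultimately show ?thesis using p[OF b] by linarith
    qed
    then obtain x :: "'d unit_cube" where x: "pt x = ?p" using exists_pt by blast
    have "pt x \<in> S" unfolding n(2) mesh_cube_def x using p by blast
    moreover have "pt x $ undefined = (of_int (n ?b) + t) / 2 ^ k"
    proof -
      have "v $ undefined = v \<bullet> ?b" for v :: "real ^ 'd" by (simp add: inner_axis)
      then have "pt x $ undefined = ?p \<bullet> ?b" unfolding x .
      also have "\<dots> = of_int (n ?b) * ?\<delta> + t * ?\<delta> * (?b \<bullet> ?b)"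
        by (simp only: inner_add_left inner_sum_left_Basis[OF b] inner_scaleR_left)
      also have "?b \<bullet> ?b = 1" by (rule inner_same_Basis[OF b])
      also have "of_int (n ?b) * ?\<delta> + t * ?\<delta> * 1 = (of_int (n ?b) + t) / 2 ^ k"
        by (simp add: add_divide_distrib)
      finally show ?thesis .
    qed
    ultimately show ?thesis by blast
  qed
  obtain x :: "'d unit_cube" where x: "pt x \<in> S" "pt x $ undefined = (of_int (n ?b) + 0) / 2 ^ k"
    using point[OF order.refl zero_le_one] by blast
  obtain y :: "'d unit_cube" where y: "pt y \<in> S" "pt y $ undefined = (of_int (n ?b) + 1 / 2) / 2 ^ k"
  proof -
    have "(0 :: real) \<le> 1 / 2" "1 / 2 \<le> (1 :: real)" by simp_all
    from point[OF this] that show thesis by blast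
  qed
  obtain z :: "'d unit_cube" where z: "pt z \<in> S" "pt z $ undefined = (of_int (n ?b) + 1) / 2 ^ k"
    using point[OF zero_le_one order.refl] by blast
  have "probe_fun s y - (probe_fun s x + probe_fun s z) / 2 = probe_coeff s k / 2"
    unfolding apply_probe_fun[OF s] x(2) y(2) z(2)
    by (simp only: add_0_right takagi_second_difference[OF summable_probe_coeff[OF s] probe_coeff_nonneg])
  moreover have "probe_fun s y - probe_fun s x \<le> oscillation (probe_fun s) S"
    by (rule abs_le_D1[OF abs_diff_le_oscillation[OF y(1) x(1)]])
  moreover have "probe_fun s y - probe_fun s z \<le> oscillation (probe_fun s) S"
    by (rule abs_le_D1[OF abs_diff_le_oscillation[OF y(1) z(1)]])
  ultimately show ?thesis by (simp add: field_simps)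
qed

lemma osc_sum_probe_fun_ge:
  assumes s: "0 \<le> s"
  shows "2 powr (real k * (real CARD('d) - s)) / (2 * real (Suc k) ^ 2)
    \<le> osc_sum (1 / 2 ^ k) (probe_fun s :: 'd::finite unit_cube \<Rightarrow>\<^sub>C real)"
proof -
  have "(1 / 2 ^ k) powr - real CARD('d) * (probe_coeff s k / 2)
      \<le> osc_sum (1 / 2 ^ k) (probe_fun s :: 'd unit_cube \<Rightarrow>\<^sub>C real)"
    by (intro osc_sum_ge probe_fun_oscillation_ge[OF s]) (simp_all add: probe_coeff_nonneg)
  moreover have "(1 / 2 ^ k) powr - real CARD('d) = 2 powr (real k * real CARD('d))"
  proof -
    have "(1 / 2 ^ k :: real) = 2 powr - real k" by (simp add: powr_minus powr_realpow divide_inverse)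
    then show ?thesis by (simp only: powr_powr minus_mult_minus)
  qed
  moreover have "2 powr (real k * real CARD('d)) * (probe_coeff s k / 2)
      = 2 powr (real k * (real CARD('d) - s)) / (2 * real (Suc k) ^ 2)"
  proof -
    have "2 powr (real k * real CARD('d)) * 2 powr - (real k * s) = 2 powr (real k * (real CARD('d) - s))"
      unfolding powr_add[symmetric] by (simp add: right_diff_distrib)
    from this[symmetric] show ?thesis by (simp only: probe_coeff_def times_divide_eq_right divide_divide_eq_left mult.commute)
  qed
  ultimately show ?thesis by simp
qed

section \<open>Prevalence\<close>

lemma compact_graph: "compact (graph f)"
proof -
  have "graph f = range (\<lambda>x. (pt x, f x))" by (auto simp: graph_def)
  moreover have "compact (range (\<lambda>x. (pt x, f x)))"
    by (intro compact_continuous_image compact_UNIV_unit_cube continuous_on_Pair continuous_on_pt)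
      (simp add: continuous_on_apply_bcontfun)
  ultimately show ?thesis by simp
qed

text \<open>The compact graph has a positive distance \<open>e\<close> from \<open>Q\<close>, and a
  perturbation of sup norm less than \<open>e\<close> moves each of its points vertically by less
  than \<open>e\<close>.\<close>

lemma eventually_disjoint_graph:
  assumes "closed Q" "Q \<inter> graph f = {}"
  shows "\<forall>\<^sub>F g in nhds f. Q \<inter> graph g = {}"
proof -
  obtain e where e: "0 < e" "\<And>p q. p \<in> graph f \<Longrightarrow> q \<in> Q \<Longrightarrow> e \<le> dist p q"
    using separate_compact_closed[OF compact_graph assms(1)] assms(2) by (metis inf_commute)
  show ?thesis
    unfolding eventually_nhds_metric
  proof (intro exI conjI allI impI)
    fix g assume g: "dist g f < e"
    have "(pt x, g x) \<notin> Q" for x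
    proof
      assume "(pt x, g x) \<in> Q"
      then have "e \<le> dist (pt x, f x) (pt x, g x)" by (intro e(2)) (auto simp: graph_def)
      also have "\<dots> = dist (g x) (f x)" by (simp add: dist_Pair_Pair dist_commute)
      also have "\<dots> \<le> dist g f" by (rule dist_bounded)
      finally show False using g by simp
    qed
    then show "Q \<inter> graph g = {}" by (auto simp: graph_def)
  qed (fact e(1))
qed

text \<open>A closed cube missed by the graph of \<open>f\<close> is missed by all nearby graphs.
  Functions within distance 1 have graphs in the bounded set \<open>B\<close>, so only finitely many
  cubes need to be avoided at once.\<close>

lemma eventually_box_count_graph_le:
  fixes f :: "'d::finite unit_cube \<Rightarrow>\<^sub>C real"
  assumes \<delta>: "0 < \<delta>"
  shows "\<forall>\<^sub>F g in nhds f. box_count \<delta> (graph g) \<le> box_count \<delta> (graph f)"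
proof -
  define B where "B = range (pt :: 'd unit_cube \<Rightarrow> real ^ 'd) \<times> cball (0 :: real) (norm f + 1)"
  define \<Q> where "\<Q> = {Q. (\<exists>n. Q = mesh_cube \<delta> n) \<and> Q \<inter> B \<noteq> {}}"
  have "bounded B"
    unfolding B_def by (intro bounded_Times compact_imp_bounded compact_continuous_image
      continuous_on_pt compact_UNIV_unit_cube compact_cball)
  then have "finite \<Q>" unfolding \<Q>_def using \<delta> by (rule finite_mesh_cubes_meeting)
  then have "finite {Q \<in> \<Q>. Q \<inter> graph f = {}}" by simp
  then have "\<forall>\<^sub>F g in nhds f. \<forall>Q\<in>{Q \<in> \<Q>. Q \<inter> graph f = {}}. Q \<inter> graph g = {}"
    by (rule eventually_ball_finite) (auto simp: \<Q>_def closed_mesh_cube intro: eventually_disjoint_graph)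
  moreover have "\<forall>\<^sub>F g in nhds f. dist g f < 1"
    using eventually_nhds_metric zero_less_one by blast
  ultimately show ?thesis
  proof eventually_elim
    case (elim g)
    have "graph g \<subseteq> B"
    proof
      fix z assume "z \<in> graph g"
      then obtain x where z: "z = (pt x, g x)" by (auto simp: graph_def)
      have "norm (g x) \<le> norm g" by (rule norm_bounded)
      also have "norm g \<le> norm f + 1" using elim(2) norm_triangle_sub[of g f] by (simp add: dist_norm)
      finally show "z \<in> B" by (simp add: z B_def)
    qed
    then have "{Q. (\<exists>n. Q = mesh_cube \<delta> n) \<and> Q \<inter> graph g \<noteq> {}}
        \<subseteq> {Q. (\<exists>n. Q = mesh_cube \<delta> n) \<and> Q \<inter> graph f \<noteq> {}}"
      using elim(1) unfolding \<Q>_def by blast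
    then show ?case
      unfolding box_count_def by (rule card_mono[OF finite_mesh_cubes_meeting[OF bounded_graph \<delta>]])
  qed
qed

lemma closed_box_count_graph_ge:
  assumes "0 < \<delta>"
  shows "closed {f :: 'd::finite unit_cube \<Rightarrow>\<^sub>C real. r \<le> real (box_count \<delta> (graph f))}"
proof -
  have "open {f :: 'd unit_cube \<Rightarrow>\<^sub>C real. real (box_count \<delta> (graph f)) < r}"
    unfolding open_dist
  proof
    fix f :: "'d unit_cube \<Rightarrow>\<^sub>C real" assume "f \<in> {f. real (box_count \<delta> (graph f)) < r}"
    then have f: "real (box_count \<delta> (graph f)) < r" by simp
    have "\<forall>\<^sub>F g in nhds f. g \<in> {f. real (box_count \<delta> (graph f)) < r}"
      using eventually_box_count_graph_le[OF assms, of f]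
    proof (rule eventually_mono)
      fix g assume "box_count \<delta> (graph g) \<le> box_count \<delta> (graph f)"
      then show "g \<in> {f. real (box_count \<delta> (graph f)) < r}" using f by simp
    qed
    then show "\<exists>e>0. \<forall>y. dist y f < e \<longrightarrow> y \<in> {f. real (box_count \<delta> (graph f)) < r}"
      unfolding eventually_nhds_metric .
  qed
  moreover have "- {f :: 'd unit_cube \<Rightarrow>\<^sub>C real. r \<le> real (box_count \<delta> (graph f))}
      = {f. real (box_count \<delta> (graph f)) < r}" by auto
  ultimately show ?thesis by (simp add: closed_def)
qed

section \<open>Null sets on the probe line\<close>

text \<open>An interval of radius \<open>r k\<close> around any point of \<open>E k\<close> contains
  \<open>E k\<close>. Borel--Cantelli is applied to these intervals, whose lengths are
  summable.\<close>

lemma null_set_of_summable_widths: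
  fixes E :: "nat \<Rightarrow> real set"
  assumes "summable r" and r: "\<And>k. 0 \<le> r k"
    and E: "\<And>k c c'. c \<in> E k \<Longrightarrow> c' \<in> E k \<Longrightarrow> \<bar>c - c'\<bar> \<le> r k"
  obtains N where "N \<in> null_sets lborel" "\<And>c. c \<notin> N \<Longrightarrow> \<forall>\<^sub>F k in sequentially. c \<notin> E k"
proof
  \<comment> \<open>If \<open>E k\<close> is empty, \<open>p k\<close> is an arbitrary real and the
    interval around it does no harm.\<close>
  define p where "p k = (SOME c. c \<in> E k)" for k
  define I where "I k = {p k - r k..p k + r k}" for k
  have sub: "c \<in> I k" if c: "c \<in> E k" for c k
  proof -
    have "p k \<in> E k" unfolding p_def using c by (rule someI)
    then show ?thesis using E[OF c, of "p k"] by (simp add: I_def abs_le_iff)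
  qed
  show "limsup I \<in> null_sets lborel"
  proof (rule borel_cantelli_limsup1)
    show "summable (\<lambda>k. measure lborel (I k))"
      using summable_mult[OF assms(1), of 2] r by (simp add: I_def)
  qed (simp_all add: I_def r)
  show "\<forall>\<^sub>F k in sequentially. c \<notin> E k" if "c \<notin> limsup I" for c
    using that sub unfolding limsup_INF_SUP eventually_sequentially by auto
qed

text \<open>In the product over the single index 0 the coordinates of points of \<open>A\<close> lie
  in the cylinder over \<open>N\<close>, which is null. The completion makes every subset of it
  null.\<close>

lemma lebesgue_null_line:
  assumes N: "N \<in> null_sets lborel" and sub: "\<And>c. c *\<^sub>R v \<in> A \<Longrightarrow> c \<in> N"
  shows "lebesgue_null 1 (\<lambda>_. v) A"
proof -
  interpret product_sigma_finite "\<lambda>_ :: nat. lborel :: real measure" ..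
  let ?M = "Pi\<^sub>M {..<1 :: nat} (\<lambda>_. lborel :: real measure)"
  let ?X = "\<Pi>\<^sub>E i\<in>{..<1 :: nat}. N"
  have N': "N \<in> sets lborel" "emeasure lborel N = 0" using N by auto
  have "emeasure ?M ?X = 0"
    using N' by (subst emeasure_PiM) auto
  moreover have "?X \<in> sets ?M"
    using N' by (intro sets_PiM_I_finite) auto
  ultimately have "?X \<in> null_sets (completion ?M)"
    by (intro null_sets_completionI) (auto simp: null_sets_def)
  moreover have "{c \<in> {..<1 :: nat} \<rightarrow>\<^sub>E UNIV. (\<Sum>i<1. c i *\<^sub>R v) \<in> A} \<subseteq> ?X"
  proof
    fix c assume "c \<in> {c \<in> {..<1 :: nat} \<rightarrow>\<^sub>E UNIV. (\<Sum>i<1. c i *\<^sub>R v) \<in> A}"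
    then have c: "c \<in> {..<1 :: nat} \<rightarrow>\<^sub>E UNIV" "c 0 *\<^sub>R v \<in> A" by auto
    show "c \<in> ?X" using c(1) sub[OF c(2)] by (auto simp: PiE_iff)
  qed
  ultimately show ?thesis
    unfolding lebesgue_null_def using null_sets_completion_subset by blast
qed

section \<open>Borel measurability\<close>

text \<open>Slacks \<open>1 / (n + 1)\<close> and thresholds \<open>1 / (m + 1)\<close> suffice by
  monotonicity. The remaining quantifier over \<open>\<delta>\<close> is uncountable, but it will
  only give an intersection of closed sets.\<close>

lemma le_lower_box_dim_iff_countable:
  assumes F: "bounded F" "F \<noteq> {}"
  shows "ereal a \<le> lower_box_dim F \<longleftrightarrow> (\<forall>n. \<exists>m. \<forall>\<delta>\<in>{0<..<1 / real (Suc m)}.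
    \<delta> powr - (a - 1 / real (Suc n)) \<le> real (box_count \<delta> F))"
  (is "_ \<longleftrightarrow> (\<forall>n. \<exists>m. ?A n m)")
  unfolding le_lower_box_dim_iff[OF F]
proof (intro iffI allI impI)
  fix n
  assume L: "\<forall>e>0. \<forall>\<^sub>F \<delta> in at_right 0. \<delta> powr - (a - e) \<le> real (box_count \<delta> F)"
  have "\<forall>\<^sub>F \<delta> in at_right 0. \<delta> powr - (a - 1 / real (Suc n)) \<le> real (box_count \<delta> F)"
    by (rule L[rule_format]) simp
  then obtain b where b: "0 < b"
    "\<forall>\<delta>>0. \<delta> < b \<longrightarrow> \<delta> powr - (a - 1 / real (Suc n)) \<le> real (box_count \<delta> F)"
    unfolding eventually_at_right_field by blast
  obtain m where m: "1 / real (Suc m) < b" using nat_approx_posE[OF b(1)] .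
  have "?A n m"
  proof
    fix \<delta> :: real assume "\<delta> \<in> {0<..<1 / real (Suc m)}"
    then have "0 < \<delta>" "\<delta> < b" using m by (simp_all del: of_nat_Suc)
    then show "\<delta> powr - (a - 1 / real (Suc n)) \<le> real (box_count \<delta> F)" using b(2) by blast
  qed
  then show "\<exists>m. ?A n m" by (rule exI)
next
  fix e :: real assume A: "\<forall>n. \<exists>m. ?A n m" and e: "0 < e"
  obtain n where n: "1 / real (Suc n) < e" using nat_approx_posE[OF e] .
  obtain m where m: "?A n m" using A by blast
  have "0 < 1 / real (Suc m)" by simp
  from eventually_at_right_0_less[OF this]
  show "\<forall>\<^sub>F \<delta> in at_right 0. \<delta> powr - (a - e) \<le> real (box_count \<delta> F)"
  proof (rule eventually_mono)
    fix \<delta> :: real assume \<delta>: "0 < \<delta> \<and> \<delta> < 1 / real (Suc m)"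
    have "1 / real (Suc m) \<le> 1" by simp
    with \<delta> have "\<delta> \<le> 1" by linarith
    then have "\<delta> powr - (a - e) \<le> \<delta> powr - (a - 1 / real (Suc n))"
      using n \<delta> by (intro powr_mono') linarith+
    also have "\<dots> \<le> real (box_count \<delta> F)"
      using m \<delta> by (simp only: greaterThanLessThan_iff Ball_def)
    finally show "\<delta> powr - (a - e) \<le> real (box_count \<delta> F)" .
  qed
qed

text \<open>The countable form of the dimension bound exhibits the set as a countable intersection
  of countable unions of sets closed for the sup norm. The assumption \<open>fine\<close> keeps
  their traces on \<open>C_space \<alpha>\<close> closed in \<open>T\<close>.\<close>

lemma borel_subset_D_space:
  fixes T :: "('d::finite unit_cube \<Rightarrow>\<^sub>C real) topology"
  assumes T: "topspace T = C_space \<alpha>" and fine: "\<And>U. closed U \<Longrightarrow> closedin T (C_space \<alpha> \<inter> U)"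
  shows "borel_subset T (D_space \<alpha>)"
proof -
  let ?\<Sigma> = "sigma_sets (topspace T) {U. openin T U}"
  interpret sigma_algebra "topspace T" ?\<Sigma>
    by (rule sigma_algebra_sigma_sets) (auto dest: openin_subset)
  define A where "A n m = {f :: 'd unit_cube \<Rightarrow>\<^sub>C real. \<forall>\<delta>\<in>{0<..<1 / real (Suc m)}.
    \<delta> powr - (\<alpha> - 1 / real (Suc n)) \<le> real (box_count \<delta> (graph f))}" for n m
  have A: "C_space \<alpha> \<inter> A n m \<in> ?\<Sigma>" for n m
  proof -
    have "A n m = (\<Inter>\<delta>\<in>{0<..<1 / real (Suc m)}.
        {f. \<delta> powr - (\<alpha> - 1 / real (Suc n)) \<le> real (box_count \<delta> (graph f))})"
      by (auto simp: A_def)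
    also have "closed \<dots>" by (intro closed_INT ballI closed_box_count_graph_ge) simp
    finally have C: "closedin T (C_space \<alpha> \<inter> A n m)" by (rule fine)
    then have "topspace T - (topspace T - C_space \<alpha> \<inter> A n m) \<in> ?\<Sigma>"
      by (intro sigma_sets.Compl sigma_sets.Basic) (simp add: closedin_def)
    then show ?thesis by (simp add: double_diff[OF closedin_subset[OF C] order.refl])
  qed
  have "D_space \<alpha> = (\<Inter>n. \<Union>m. C_space \<alpha> \<inter> A n m)"
  proof (rule set_eqI)
    fix f :: "'d unit_cube \<Rightarrow>\<^sub>C real"
    have "f \<in> D_space \<alpha> \<longleftrightarrow> f \<in> C_space \<alpha> \<and> (\<forall>n. \<exists>m. f \<in> A n m)"
      by (simp only: D_space_eq A_def mem_Collect_eq le_lower_box_dim_iff_countable[OF bounded_graph graph_nonempty])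
    then show "f \<in> D_space \<alpha> \<longleftrightarrow> f \<in> (\<Inter>n. \<Union>m. C_space \<alpha> \<inter> A n m)" by blast
  qed
  also have "\<dots> \<in> ?\<Sigma>"
    using A by (intro countable_INT countable_UN image_subsetI) simp_all
  finally show ?thesis unfolding borel_subset_def .
qed

text \<open>The set \<open>E k\<close> of bad coefficients has diameter \<open>O(1 / k\<^sup>2)\<close>, because \<open>osc_sum\<close> is a seminorm;
  this also spares any measurability argument.\<close>

lemma ae_lower_box_dim_line_ge:
  fixes g :: "'d::finite unit_cube \<Rightarrow>\<^sub>C real"
  assumes \<alpha>: "real CARD('d) \<le> \<alpha>" "\<alpha> \<le> real CARD('d) + 1"
  defines "h \<equiv> probe_fun (real CARD('d) + 1 - \<alpha>) :: 'd unit_cube \<Rightarrow>\<^sub>C real"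
  obtains N where "N \<in> null_sets lborel"
    "\<And>c. c \<notin> N \<Longrightarrow> ereal \<alpha> \<le> lower_box_dim (graph (c *\<^sub>R h - g))"
proof -
  let ?s = "real CARD('d) + 1 - \<alpha>"
  define V where "V k = osc_sum (1 / 2 ^ k) h" for k
  have V: "2 powr (real k * (\<alpha> - 1)) / (2 * real (Suc k) ^ 2) \<le> V k" for k
    using osc_sum_probe_fun_ge[of ?s k, where 'd = 'd] \<alpha> by (simp add: V_def h_def algebra_simps)
  have V_pos: "0 < V k" for k
    by (rule less_le_trans[OF _ V]) simp
  \<comment> \<open>The threshold makes the widths summable and costs only a polynomial factor in
    \<open>k\<close>.\<close>
  define E where "E k = {c. osc_sum (1 / 2 ^ k) (c *\<^sub>R h - g) < V k / real (Suc k) ^ 2}" for k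
  define r where "r k = 2 * (1 / real (Suc k) ^ 2)" for k
  have summable: "summable r"
    unfolding r_def by (rule summable_mult[OF summable_inverse_Suc_square])
  have width: "\<bar>c - c'\<bar> \<le> r k" if c: "c \<in> E k" "c' \<in> E k" for c c' k
  proof -
    have "\<bar>c - c'\<bar> * V k = osc_sum (1 / 2 ^ k) ((c - c') *\<^sub>R h)"
      unfolding V_def by (rule osc_sum_scaleR[symmetric]) simp
    \<comment> \<open>The common translate \<open>g\<close> cancels in the difference.\<close>
    also have "(c - c') *\<^sub>R h = (c *\<^sub>R h - g) + (- 1) *\<^sub>R (c' *\<^sub>R h - g)"
      by (simp add: scaleR_diff_left)
    also have "osc_sum (1 / 2 ^ k) \<dots> \<le> osc_sum (1 / 2 ^ k) (c *\<^sub>R h - g)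
        + osc_sum (1 / 2 ^ k) ((- 1) *\<^sub>R (c' *\<^sub>R h - g))"
      by (rule osc_sum_add) simp
    also have "osc_sum (1 / 2 ^ k) ((- 1) *\<^sub>R (c' *\<^sub>R h - g)) = osc_sum (1 / 2 ^ k) (c' *\<^sub>R h - g)"
      by (subst osc_sum_scaleR) simp_all
    also have "osc_sum (1 / 2 ^ k) (c *\<^sub>R h - g) + osc_sum (1 / 2 ^ k) (c' *\<^sub>R h - g) \<le> r k * V k"
      using c by (simp add: E_def r_def)
    finally show ?thesis using V_pos[of k] by (simp only: mult_le_cancel_right_pos)
  qed
  obtain N where N: "N \<in> null_sets lborel" "\<And>c. c \<notin> N \<Longrightarrow> \<forall>\<^sub>F k in sequentially. c \<notin> E k"
    using null_set_of_summable_widths[of r E] summable width by (auto simp: r_def)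
  show thesis
  proof (rule that[OF N(1)])
    fix c assume "c \<notin> N"
    let ?G = "graph (c *\<^sub>R h - g)"
    have "\<forall>\<^sub>F k in sequentially.
        1 / 2 * 2 powr (real k * \<alpha>) / real (Suc k) ^ 4 \<le> real (box_count (1 / 2 ^ k) ?G)"
      using N(2)[OF \<open>c \<notin> N\<close>]
    proof eventually_elim
      case (elim k)
      have pow: "2 powr (real k * \<alpha>) = 2 ^ k * 2 powr (real k * (\<alpha> - 1))"
      proof -
        have "2 ^ k * 2 powr (real k * (\<alpha> - 1)) = 2 powr (real k + real k * (\<alpha> - 1))"
          by (simp add: powr_add powr_realpow)
        then show ?thesis by (simp add: algebra_simps)
      qed
      \<comment> \<open>Two of the four powers come from the probe coefficients, the other two from
        the threshold in \<open>E k\<close>.\<close>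
      have "1 / 2 * 2 powr (real k * \<alpha>) / real (Suc k) ^ 4
          = 2 ^ k * ((2 powr (real k * (\<alpha> - 1)) / (2 * real (Suc k) ^ 2)) / real (Suc k) ^ 2)"
      proof -
        have "1 / 2 * (a * b) / q ^ 4 = a * ((b / (2 * q ^ 2)) / q ^ 2)" for a b q :: real
          by (simp flip: power_add)
        then show ?thesis unfolding pow .
      qed
      also have "\<dots> \<le> 2 ^ k * (V k / real (Suc k) ^ 2)"
        by (intro mult_left_mono divide_right_mono V) auto
      also have "\<dots> \<le> 2 ^ k * osc_sum (1 / 2 ^ k) (c *\<^sub>R h - g)"
        using elim by (intro mult_left_mono) (auto simp: E_def)
      also have "\<dots> \<le> 2 ^ k * (1 / 2 ^ k * real (box_count (1 / 2 ^ k) ?G))"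
        by (intro mult_left_mono osc_sum_le_box_count) auto
      finally show ?case by simp
    qed
    then show "ereal \<alpha> \<le> lower_box_dim ?G"
      using \<alpha> by (intro le_lower_box_dim_of_dyadic[OF bounded_graph graph_nonempty, of \<alpha> "1 / 2"]) auto
  qed
qed

text \<open>Both claims are instances: all that is asked of \<open>T\<close> is that it lives on
  \<open>C_space \<alpha>\<close> and is at least as fine as the sup norm topology.\<close>

lemma k_prevalent_D_space:
  fixes T :: "('d::finite unit_cube \<Rightarrow>\<^sub>C real) topology"
  assumes \<alpha>: "real CARD('d) \<le> \<alpha>" "\<alpha> \<le> real CARD('d) + 1"
    and T: "topspace T = C_space \<alpha>" and fine: "\<And>U. closed U \<Longrightarrow> closedin T (C_space \<alpha> \<inter> U)"
  shows "k_prevalent T 1 (D_space \<alpha>)"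
proof -
  let ?s = "real CARD('d) + 1 - \<alpha>"
  define h :: "'d unit_cube \<Rightarrow>\<^sub>C real" where "h = probe_fun ?s"
  have "h \<noteq> 0"
  proof
    assume "h = 0"
    then have "osc_sum (1 / 2 ^ 0) h = 0" using osc_sum_scaleR[of "1 / 2 ^ 0" 0 h] by simp
    moreover have "0 < osc_sum (1 / 2 ^ 0) h"
      unfolding h_def using \<alpha> by (intro less_le_trans[OF _ osc_sum_probe_fun_ge]) auto
    ultimately show False by simp
  qed
  have "h \<in> C_space \<alpha>"
  proof (rule in_C_spaceI[OF \<alpha>(1)])
    fix \<delta> :: real assume \<delta>: "0 < \<delta>" "\<delta> \<le> 1"
    have "?s - real CARD('d) = 1 - \<alpha>" by simp
    then show "osc_sum \<delta> h \<le> 2 ^ CARD('d) * (\<Sum>k. 1 / real (Suc k) ^ 2) * \<delta> powr (1 - \<alpha>)"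
      using osc_sum_probe_fun_le[of ?s \<delta>, where 'd = 'd] \<alpha> \<delta> unfolding h_def by simp
  qed
  note C = subspace_C_space[OF \<alpha>(1)]
  have "probe T 1 (D_space \<alpha>) (span {h})"
    unfolding probe_def
  proof (intro conjI exI ballI)
    show "span {h} \<subseteq> topspace T" unfolding T using C \<open>h \<in> C_space \<alpha>\<close> by (intro span_minimal) auto
    show "is_basis 1 (\<lambda>_. h) (span {h})"
      using \<open>h \<noteq> 0\<close> by (simp add: is_basis_def lessThan_Suc dependent_single)
    fix g assume "g \<in> topspace T"
    then have g: "g \<in> C_space \<alpha>" by (simp add: T)
    obtain N where N: "N \<in> null_sets lborel"
      "\<And>c. c \<notin> N \<Longrightarrow> ereal \<alpha> \<le> lower_box_dim (graph (c *\<^sub>R h - g))"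
      using ae_lower_box_dim_line_ge[OF \<alpha>, of g] unfolding h_def by blast
    show "lebesgue_null 1 (\<lambda>_. h) (topspace T - (\<lambda>y. y + g) ` D_space \<alpha>)"
    proof (rule lebesgue_null_line[OF N(1)])
      fix c assume c: "c *\<^sub>R h \<in> topspace T - (\<lambda>y. y + g) ` D_space \<alpha>"
      show "c \<in> N"
      proof (rule ccontr)
        assume "c \<notin> N"
        \<comment> \<open>The upper dimension bound comes for free from the subspace property; only
          the lower bound excludes a null set of \<open>c\<close>.\<close>
        moreover have "c *\<^sub>R h - g \<in> C_space \<alpha>"
          using c g C by (intro subspace_diff) (auto simp: T)
        ultimately have "c *\<^sub>R h - g \<in> D_space \<alpha>" using N(2) by (simp add: D_space_eq)
        then have "(c *\<^sub>R h - g) + g \<in> (\<lambda>y. y + g) ` D_space \<alpha>" by (rule imageI)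
        then show False using c by simp
      qed
    qed
  qed
  then show ?thesis
    unfolding k_prevalent_def using borel_subset_D_space[OF T fine] by blast
qed

section \<open>The metric\<close>

definition dist_term :: "real \<Rightarrow> nat \<Rightarrow> ('d::finite unit_cube \<Rightarrow>\<^sub>C real) \<Rightarrow> real"
  where "dist_term \<alpha> k h =
    real_of_ereal (min (ereal ((1 / 2) ^ Suc k)) (osc_norm (\<alpha> + 1 / real (Suc k)) h))"

text \<open>The supremum is nonnegative because its member at scale 1 is.\<close>

lemma norm_le_osc_norm: "ereal (norm h) \<le> osc_norm \<beta> h"
proof -
  have "0 \<le> ereal (1 powr (\<beta> - 1) * (\<Sum>S\<in>unit_mesh 1. oscillation h S))"
    using osc_sum_nonneg[of 1 h] by (simp add: osc_sum_def)
  also have "\<dots> \<le> (SUP \<delta>\<in>{0<..1}. ereal (\<delta> powr (\<beta> - 1) * (\<Sum>S\<in>unit_mesh \<delta>. oscillation h S)))"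
    by (rule SUP_upper) simp
  finally show ?thesis unfolding osc_norm_def by (intro add_increasing2) auto
qed

lemma osc_norm_add: "osc_norm \<beta> (f + g) \<le> osc_norm \<beta> f + osc_norm \<beta> g"
proof -
  let ?S = "\<lambda>f. SUP \<delta>\<in>{0<..1}. ereal (\<delta> powr (\<beta> - 1) * osc_sum \<delta> f)"
  have "?S (f + g) \<le> ?S f + ?S g"
  proof (rule SUP_least)
    fix \<delta> :: real assume \<delta>: "\<delta> \<in> {0<..1}"
    have "\<delta> powr (\<beta> - 1) * osc_sum \<delta> (f + g) \<le> \<delta> powr (\<beta> - 1) * (osc_sum \<delta> f + osc_sum \<delta> g)"
      using \<delta> by (intro mult_left_mono osc_sum_add) auto
    then have "ereal (\<delta> powr (\<beta> - 1) * osc_sum \<delta> (f + g))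
        \<le> ereal (\<delta> powr (\<beta> - 1) * osc_sum \<delta> f) + ereal (\<delta> powr (\<beta> - 1) * osc_sum \<delta> g)"
      by (simp add: distrib_left)
    also have "\<dots> \<le> ?S f + ?S g"
      using \<delta> by (intro add_mono SUP_upper)
    finally show "ereal (\<delta> powr (\<beta> - 1) * osc_sum \<delta> (f + g)) \<le> ?S f + ?S g" .
  qed
  then have "ereal (norm (f + g)) + ?S (f + g) \<le> (ereal (norm f) + ereal (norm g)) + (?S f + ?S g)"
    by (intro add_mono) (simp_all add: norm_triangle_ineq)
  then show ?thesis
    unfolding osc_norm_def osc_sum_def by (simp only: add.assoc add.commute add.left_commute)
qed

lemma osc_norm_minus: "osc_norm \<beta> (- f) = osc_norm \<beta> f"
proof -
  have "oscillation (- f) S = oscillation f S" for S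
    unfolding oscillation_def by (intro arg_cong[of _ _ Sup]) (simp add: uminus_bcontfun.rep_eq abs_minus_commute)
  then show ?thesis by (simp add: osc_norm_def)
qed

lemma osc_norm_zero: "osc_norm \<beta> 0 = 0"
proof -
  have "osc_sum \<delta> (0 :: 'a unit_cube \<Rightarrow>\<^sub>C real) = 0" if "0 < \<delta>" for \<delta>
    using osc_sum_scaleR[OF that, of 0 0] by simp
  then have "(SUP \<delta>\<in>{0<..1 :: real}. ereal (\<delta> powr (\<beta> - 1) * osc_sum \<delta> (0 :: 'a unit_cube \<Rightarrow>\<^sub>C real))) = (SUP \<delta>\<in>{0<..1 :: real}. 0)"
    by (intro SUP_cong) auto
  then show ?thesis by (simp add: osc_norm_def osc_sum_def)
qed

lemma osc_norm_nonneg: "0 \<le> osc_norm \<beta> h"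
  by (rule order.trans[OF _ norm_le_osc_norm]) simp

text \<open>The minimum with a finite number is finite even where \<open>osc_norm\<close> is
  infinite, so \<open>real_of_ereal\<close> does not fall back on its default value.\<close>

lemma ereal_dist_term:
  "ereal (dist_term \<alpha> k h) = min (ereal ((1 / 2) ^ Suc k)) (osc_norm (\<alpha> + 1 / real (Suc k)) h)"
  unfolding dist_term_def using osc_norm_nonneg[of "\<alpha> + 1 / real (Suc k)" h]
  by (intro ereal_real') (auto simp: min_def)

lemma dist_term_bounds:
  "0 \<le> dist_term \<alpha> k h" "dist_term \<alpha> k h \<le> (1 / 2) ^ Suc k" "min ((1 / 2) ^ Suc k) (norm h) \<le> dist_term \<alpha> k h"
proof -
  have "ereal (min ((1 / 2) ^ Suc k) (norm h)) \<le> ereal (dist_term \<alpha> k h)"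
    unfolding ereal_dist_term ereal_min by (intro min.mono norm_le_osc_norm order.refl)
  then show m: "min ((1 / 2) ^ Suc k) (norm h) \<le> dist_term \<alpha> k h" by (simp only: ereal_less_eq)
  show "0 \<le> dist_term \<alpha> k h" by (rule order.trans[OF _ m]) simp
  have "ereal (dist_term \<alpha> k h) \<le> ereal ((1 / 2) ^ Suc k)" unfolding ereal_dist_term by simp
  then show "dist_term \<alpha> k h \<le> (1 / 2) ^ Suc k" by simp
qed

text \<open>Truncation preserves subadditivity: as soon as one summand on the right reaches the cap,
  the right side is at least the cap.\<close>

lemma dist_term_add: "dist_term \<alpha> k (f + g) \<le> dist_term \<alpha> k f + dist_term \<alpha> k g"
proof -
  have min_add: "min c z \<le> min c x + min c y"
    if "0 \<le> c" "0 \<le> x" "0 \<le> y" "z \<le> x + y" for c x y z :: ereal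
  proof -
    consider "c \<le> x" | "c \<le> y" | "x \<le> c" "y \<le> c" by (meson linear)
    then show ?thesis
    proof cases
      case 1
      then have "min c z \<le> min c x" by simp
      also have "\<dots> \<le> min c x + min c y" using that by (intro ereal_le_add_self) simp
      finally show ?thesis .
    next
      case 2
      then have "min c z \<le> min c y" by simp
      also have "\<dots> \<le> min c x + min c y" using that by (intro ereal_le_add_self2) simp
      finally show ?thesis .
    next
      case 3
      then show ?thesis using that(4) by (simp add: min_absorb2 min.coboundedI2)
    qed
  qed
  have "ereal (dist_term \<alpha> k (f + g)) \<le> ereal (dist_term \<alpha> k f) + ereal (dist_term \<alpha> k g)"
    unfolding ereal_dist_term by (rule min_add[OF _ osc_norm_nonneg osc_norm_nonneg osc_norm_add]) simp
  then show ?thesis by simp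
qed

lemma summable_dist_term: "summable (\<lambda>k. dist_term \<alpha> k h)"
proof (rule summable_comparison_test'[of "\<lambda>k. (1 / 2) ^ Suc k" 0])
  show "summable (\<lambda>k. (1 / 2 :: real) ^ Suc k)"
    unfolding summable_Suc_iff by (rule summable_geometric) simp
  show "norm (dist_term \<alpha> k h) \<le> (1 / 2) ^ Suc k" for k
    using dist_term_bounds(1,2)[of \<alpha> k h] by (simp only: real_norm_def abs_of_nonneg)
qed

lemma dist_space_eq: "dist_space \<alpha> f g = (\<Sum>k. dist_term \<alpha> k (f - g))"
  by (simp add: dist_space_def dist_term_def)

text \<open>The summand with index 0 alone, whose cap is \<open>1 / 2\<close>, controls the sup
  norm.\<close>

lemma min_half_norm_le_dist_space: "min (1 / 2) (norm (f - g)) \<le> dist_space \<alpha> f g"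
proof -
  have "dist_term \<alpha> 0 (f - g) = (\<Sum>k\<in>{0}. dist_term \<alpha> k (f - g))" by simp
  also have "\<dots> \<le> dist_space \<alpha> f g"
    unfolding dist_space_eq by (intro sum_le_suminf summable_dist_term) (auto simp: dist_term_bounds)
  finally show ?thesis using dist_term_bounds(3)[of 0 "f - g" \<alpha>] by simp
qed

text \<open>The caps make the series converge for any two continuous functions, so the metric axioms
  hold on every carrier \<open>M\<close>.\<close>

lemma Metric_space_dist_space: "Metric_space M (dist_space \<alpha>)"
proof
  fix f g h :: "'a unit_cube \<Rightarrow>\<^sub>C real"
  show "0 \<le> dist_space \<alpha> f g"
    unfolding dist_space_eq by (intro suminf_nonneg summable_dist_term dist_term_bounds)
  show "dist_space \<alpha> f g = dist_space \<alpha> g f"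
  proof -
    have "dist_space \<alpha> f g = (\<Sum>k. dist_term \<alpha> k (- (g - f)))" by (simp only: dist_space_eq minus_diff_eq)
    also have "\<dots> = dist_space \<alpha> g f" by (simp only: dist_space_eq dist_term_def osc_norm_minus)
    finally show ?thesis .
  qed
  show "dist_space \<alpha> f g = 0 \<longleftrightarrow> f = g"
  proof
    assume "dist_space \<alpha> f g = 0"
    then have "norm (f - g) \<le> 0" using min_half_norm_le_dist_space[of f g \<alpha>] by linarith
    then show "f = g" by simp
  next
    have "dist_term \<alpha> k (0 :: 'a unit_cube \<Rightarrow>\<^sub>C real) = 0" for k
      using dist_term_bounds(1)[of \<alpha> k "0 :: 'a unit_cube \<Rightarrow>\<^sub>C real"] ereal_dist_term[of \<alpha> k "0 :: 'a unit_cube \<Rightarrow>\<^sub>C real"]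
      unfolding osc_norm_zero by (metis ereal_less_eq(3) min.cobounded2 order_antisym zero_ereal_def)
    then show "dist_space \<alpha> f g = 0" if "f = g" using that by (simp add: dist_space_eq)
  qed
  have "dist_space \<alpha> f h \<le> (\<Sum>k. dist_term \<alpha> k (f - g) + dist_term \<alpha> k (g - h))"
    unfolding dist_space_eq
  proof (intro suminf_le summable_add summable_dist_term)
    show "dist_term \<alpha> k (f - h) \<le> dist_term \<alpha> k (f - g) + dist_term \<alpha> k (g - h)" for k
      using dist_term_add[of \<alpha> k "f - g" "g - h"] by simp
  qed
  then show "dist_space \<alpha> f h \<le> dist_space \<alpha> f g + dist_space \<alpha> g h"
    unfolding dist_space_eq by (simp add: suminf_add summable_dist_term)
qed

text \<open>Below \<open>1 / 2\<close> the distance dominates the sup norm, so a ball of radius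
  \<open>min e (1 / 2)\<close> lies in the sup norm ball of radius \<open>e\<close>.\<close>

lemma closedin_mtopology_dist_space:
  assumes "closed U"
  shows "closedin (Metric_space.mtopology M (dist_space \<alpha>)) (M \<inter> U)"
proof -
  interpret Metric_space M "dist_space \<alpha>" by (rule Metric_space_dist_space)
  show ?thesis
    unfolding closedin_metric
  proof (intro conjI allI impI)
    fix f assume f: "f \<in> M - M \<inter> U"
    then have "f \<in> - U" by blast
    then obtain e where e: "0 < e" "ball f e \<subseteq> - U"
      using assms openE[of "- U" f] unfolding closed_def by blast
    have "disjnt (M \<inter> U) (mball f (min e (1 / 2)))"
      unfolding disjnt_iff
    proof (intro allI notI)
      fix g assume g: "g \<in> M \<inter> U \<and> g \<in> mball f (min e (1 / 2))"
      then have "dist_space \<alpha> f g < min e (1 / 2)" by simp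
      then have "norm (f - g) < e" using min_half_norm_le_dist_space[of f g \<alpha>] by linarith
      then have "g \<in> ball f e" by (simp add: dist_norm)
      then show False using e(2) g by blast
    qed
    then show "\<exists>r>0. disjnt (M \<inter> U) (mball f r)" using e(1) by (intro exI[of _ "min e (1 / 2)"]) auto
  qed simp
qed

theorem theorem1p5:
  shows "k_prevalent (Metric_space.mtopology UNIV dist) 1
           (D_space (real CARD('d::finite) + 1) :: ('d unit_cube \<Rightarrow>\<^sub>C real) set) \<and>
         (\<forall>\<alpha>::real. real CARD('d) \<le> \<alpha> \<and> \<alpha> < real CARD('d) + 1 \<longrightarrow>
           k_prevalent (Metric_space.mtopology (C_space \<alpha>) (dist_space \<alpha>)) 1
             (D_space \<alpha> :: ('d unit_cube \<Rightarrow>\<^sub>C real) set))"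
proof (intro conjI allI impI)
  \<comment> \<open>For \<open>\<alpha> = d + 1\<close> the carrier \<open>C_space \<alpha>\<close>
    is the whole space and \<open>T\<close> is the sup norm topology itself.\<close>
  show "k_prevalent (Metric_space.mtopology UNIV dist) 1
           (D_space (real CARD('d) + 1) :: ('d unit_cube \<Rightarrow>\<^sub>C real) set)"
    by (rule k_prevalent_D_space) (simp_all add: C_space_top)
next
  fix \<alpha> :: real assume \<alpha>: "real CARD('d) \<le> \<alpha> \<and> \<alpha> < real CARD('d) + 1"
  show "k_prevalent (Metric_space.mtopology (C_space \<alpha>) (dist_space \<alpha>)) 1
             (D_space \<alpha> :: ('d unit_cube \<Rightarrow>\<^sub>C real) set)"
    using \<alpha> by (intro k_prevalent_D_space closedin_mtopology_dist_space)
      (simp_all add: Metric_space.topspace_mtopology[OF Metric_space_dist_space])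
qed

end
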